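(* Let $S=\begin{pmatrix}a&b\\c&d\end{pmatrix}$ and $T=\begin{pmatrix}\lambda&0\\0&\mu\end{pmatrix}$ be elements of $\mathrm{SL}(2,\mathbb H)$. If $\langle S,T\rangle$ is discrete, non-elementary and $$\{(\Re\lambda-\Re\mu)^2+(|\Im\lambda|+|\Im\mu|)^2\}\,(1+|bc|)=1,$$ then $T$ is elliptic of order at least seven.
   Context: $\mathbb H$ is the division ring of real quaternions. For $q=q_0+q_1i+q_2j+q_3k\in\mathbb H$ ($q_0,\dots,q_3\in\mathbb R$): $\Re q=q_0$, $\Im q=q_1i+q_2j+q_3k$ (a quaternion), $\overline q=\Re q-\Im q$, $|q|=\sqrt{q_0^2+q_1^2+q_2^2+q_3^2}$. For a $2\times2$ quaternionic matrix $A=\begin{pmatrix}a&b\\c&d\end{pmatrix}$, $\det A=\sqrt{|a|^2|d|^2+|b|^2|c|^2-2\Re(a\overline c d\overline b)}$ (which equals $|ad-aca^{-1}b|$ when $a\ne0$); $\mathrm{SL}(2,\mathbb H)$ is the group of such matrices with $\det=1$. It acts on $\widehat{\mathbb H}=\mathbb H\cup\{\infty\}$ by $Z\mapsto(aZ+b)(cZ+d)^{-1}$, and by Poincaré extension on hyperbolic 5-space $\mathbf H^5$ (with boundary $\widehat{\mathbb H}$) by orientation-preserving isometries. A subgroup is elementary if it has a finite orbit in $\mathbf H^5\cup\widehat{\mathbb H}$, and non-elementary otherwise. An element is elliptic if it has a fixed point in $\mathbf H^5$; for a diagonal matrix with diagonal entries $\lambda,\mu$ in $\mathrm{SL}(2,\mathbb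 H)$ this means $|\lambda|=|\mu|=1$. The order of an elliptic element is the order of the isometry of $\mathbf H^5$ it induces. *)

theory Defs
  imports
    "HOL-Analysis.Analysis"
    "HOL-Algebra.Bij"
    "HOL-Algebra.Generated_Groups"
    "HOL-Algebra.Multiplicative_Group"
begin

section \<open>Quaternions\<close>

datatype quat = Quat (qRe: real) (qI: real) (qJ: real) (qK: real)

lemma quat_eq_iff: "p = q \<longleftrightarrow> qRe p = qRe q \<and> qI p = qI q \<and> qJ p = qJ q \<and> qK p = qK q"
  by (cases p; cases q) simp

instantiation quat :: ring_1
begin

definition "0 = Quat 0 0 0 0"
definition "1 = Quat 1 0 0 0"
definition "p + q = Quat (qRe p + qRe q) (qI p + qI q) (qJ p + qJ q) (qK p + qK q)"
definition "- q = Quat (- qRe q) (- qI q) (- qJ q) (- qK q)"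
definition "p - q = Quat (qRe p - qRe q) (qI p - qI q) (qJ p - qJ q) (qK p - qK q)"
definition "p * q = Quat
  (qRe p * qRe q - qI p * qI q - qJ p * qJ q - qK p * qK q)
  (qRe p * qI q + qI p * qRe q + qJ p * qK q - qK p * qJ q)
  (qRe p * qJ q - qI p * qK q + qJ p * qRe q + qK p * qI q)
  (qRe p * qK q + qI p * qJ q - qJ p * qI q + qK p * qRe q)"

instance
  by standard
    (simp_all add: quat_eq_iff zero_quat_def one_quat_def plus_quat_def uminus_quat_def
      minus_quat_def times_quat_def algebra_simps)

end

instantiation quat :: real_vector
begin

definition "scaleR r q = Quat (r * qRe q) (r * qI q) (r * qJ q) (r * qK q)"

instance
  by standard
    (simp_all add: quat_eq_iff plus_quat_def scaleR_quat_def algebra_simps)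

end

instantiation quat :: real_inner
begin

definition "inner p q = qRe p * qRe q + qI p * qI q + qJ p * qJ q + qK p * qK q"
definition "norm q = sqrt ((qRe q)\<^sup>2 + (qI q)\<^sup>2 + (qJ q)\<^sup>2 + (qK q)\<^sup>2)"
definition "sgn q = q /\<^sub>R norm (q :: quat)"
definition "dist p q = norm (p - q :: quat)"
definition
  "(uniformity :: (quat \<times> quat) filter) = (INF e\<in>{0<..}. principal {(x, y). dist x y < e})"
definition
  "open (U :: quat set) \<longleftrightarrow> (\<forall>x\<in>U. eventually (\<lambda>(x', y). x' = x \<longrightarrow> y \<in> U) uniformity)"

instance
proof
  fix x y z :: quat and r s :: real
  show "inner x x \<ge> 0"
    by (simp add: inner_quat_def)
  have *: "a * a + b * b + c * c + d * d = 0 \<longleftrightarrow> a = 0 \<and> b = 0 \<and> c = 0 \<and> d = 0" for a b c d :: real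
    by (smt (verit) mult_eq_0_iff zero_le_square not_real_square_gt_zero)
  show "inner x x = 0 \<longleftrightarrow> x = 0"
    unfolding inner_quat_def * by (simp add: zero_quat_def quat_eq_iff)
qed (simp_all add: quat_eq_iff zero_quat_def plus_quat_def minus_quat_def scaleR_quat_def
      inner_quat_def norm_quat_def power2_eq_square sgn_quat_def dist_quat_def
      uniformity_quat_def open_quat_def algebra_simps)

end

lemma quat_simps [simp]:
  "qRe 0 = 0" "qI 0 = 0" "qJ 0 = 0" "qK 0 = 0"
  "qRe 1 = 1" "qI 1 = 0" "qJ 1 = 0" "qK 1 = 0"
  "qRe (p + q) = qRe p + qRe q" "qI (p + q) = qI p + qI q"
  "qJ (p + q) = qJ p + qJ q" "qK (p + q) = qK p + qK q"
  "qRe (p - q) = qRe p - qRe q" "qI (p - q) = qI p - qI q"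
  "qJ (p - q) = qJ p - qJ q" "qK (p - q) = qK p - qK q"
  "qRe (- q) = - qRe q" "qI (- q) = - qI q" "qJ (- q) = - qJ q" "qK (- q) = - qK q"
  "qRe (r *\<^sub>R q) = r * qRe q" "qI (r *\<^sub>R q) = r * qI q"
  "qJ (r *\<^sub>R q) = r * qJ q" "qK (r *\<^sub>R q) = r * qK q"
  by (simp_all add: zero_quat_def one_quat_def plus_quat_def minus_quat_def uminus_quat_def
      scaleR_quat_def)

lemma quat_mult_simps:
  "qRe (p * q) = qRe p * qRe q - qI p * qI q - qJ p * qJ q - qK p * qK q"
  "qI (p * q) = qRe p * qI q + qI p * qRe q + qJ p * qK q - qK p * qJ q"
  "qJ (p * q) = qRe p * qJ q - qI p * qK q + qJ p * qRe q + qK p * qI q"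
  "qK (p * q) = qRe p * qK q + qI p * qJ q - qJ p * qI q + qK p * qRe q"
  by (simp_all add: times_quat_def)

instance quat :: real_algebra_1
  by standard (simp_all add: quat_eq_iff quat_mult_simps algebra_simps)

definition qIm :: "quat \<Rightarrow> quat" where
  "qIm q = Quat 0 (qI q) (qJ q) (qK q)"

definition qcnj :: "quat \<Rightarrow> quat" where
  "qcnj q = of_real (qRe q) - qIm q"

lemma norm_quat_power2: "(norm q)\<^sup>2 = (qRe q)\<^sup>2 + (qI q)\<^sup>2 + (qJ q)\<^sup>2 + (qK q)\<^sup>2" for q :: quat
  by (simp add: norm_quat_def)

lemma qcnj_simps [simp]:
  "qRe (qcnj q) = qRe q" "qI (qcnj q) = - qI q" "qJ (qcnj q) = - qJ q" "qK (qcnj q) = - qK q"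
  by (simp_all add: qcnj_def qIm_def of_real_def)

lemma qcnj_mult: "qcnj (p * q) = qcnj q * qcnj p"
  by (simp add: quat_eq_iff quat_mult_simps algebra_simps)

lemma qcnj_add: "qcnj (p + q) = qcnj p + qcnj q"
  by (simp add: quat_eq_iff)

lemma qcnj_0 [simp]: "qcnj 0 = 0"
  by (simp add: quat_eq_iff)

lemma qcnj_qcnj [simp]: "qcnj (qcnj q) = q"
  by (simp add: quat_eq_iff)

lemma mult_qcnj: "q * qcnj q = of_real ((norm q)\<^sup>2)" "qcnj q * q = of_real ((norm q)\<^sup>2)"
  by (simp_all add: quat_eq_iff quat_mult_simps norm_quat_power2 of_real_def)
    (simp_all add: power2_eq_square algebra_simps)

instantiation quat :: real_normed_div_algebra
begin

definition "inverse q = qcnj q /\<^sub>R (norm q)\<^sup>2"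
definition "p div q = p * inverse (q :: quat)"

instance
proof
  fix x y :: quat
  show "inverse x * x = 1" "x * inverse x = 1" if "x \<noteq> 0"
    using that by (simp_all add: inverse_quat_def mult_qcnj of_real_def)
  show "norm (x * y) = norm x * norm y"
    unfolding norm_quat_def real_sqrt_mult [symmetric]
    by (simp add: quat_mult_simps power2_eq_square algebra_simps)
qed (simp_all add: inverse_quat_def divide_quat_def quat_eq_iff)

end

lemma qRe_commute: "qRe (p * q) = qRe (q * p)"
  by (simp add: quat_mult_simps algebra_simps)


section \<open>The group SL(2,H)\<close>

definition mat2 :: "'a::zero \<Rightarrow> 'a \<Rightarrow> 'a \<Rightarrow> 'a \<Rightarrow> 'a^2^2" where
  "mat2 a b c d = vector [vector [a, b], vector [c, d]]"

lemma mat2_nth [simp]: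
  "mat2 a b c d $ 1 $ 1 = a" "mat2 a b c d $ 1 $ 2 = b"
  "mat2 a b c d $ 2 $ 1 = c" "mat2 a b c d $ 2 $ 2 = d"
  by (simp_all add: mat2_def)

lemma mat2_eta: "mat2 (A $ 1 $ 1) (A $ 1 $ 2) (A $ 2 $ 1) (A $ 2 $ 2) = A"
  by (simp add: vec_eq_iff forall_2)

lemma mat2_cong:
  "a = a' \<Longrightarrow> b = b' \<Longrightarrow> c = c' \<Longrightarrow> d = d' \<Longrightarrow> mat2 a b c d = mat2 a' b' c' d'"
  by simp

lemma mat2_mult:
  fixes a :: "'a::semiring_1"
  shows "mat2 a b c d ** mat2 e f g h
    = mat2 (a * e + b * g) (a * f + b * h) (c * e + d * g) (c * f + d * h)"
  by (simp add: vec_eq_iff forall_2 matrix_matrix_mult_def sum_2)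

lemma mat2_one: "mat 1 = mat2 1 0 0 (1::'a::semiring_1)"
  by (simp add: vec_eq_iff forall_2 mat_def)

text \<open>
  The determinant is real-valued (up to normalisation, the Dieudonne determinant).  Its square is
  the quantity \<open>qdet_sq\<close> of the entries, which is also the Gram determinant of the two rows;
  this makes the invariance under row operations, and hence multiplicativity, visible.
\<close>

definition qdet_sq :: "quat \<Rightarrow> quat \<Rightarrow> quat \<Rightarrow> quat \<Rightarrow> real" where
  "qdet_sq a b c d = (norm a)\<^sup>2 * (norm d)\<^sup>2 + (norm b)\<^sup>2 * (norm c)\<^sup>2
     - 2 * qRe (a * qcnj c * d * qcnj b)"

definition qdet :: "quat^2^2 \<Rightarrow> real" where
  "qdet A = sqrt (qdet_sq (A $ 1 $ 1) (A $ 1 $ 2) (A $ 2 $ 1) (A $ 2 $ 2))"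

definition SL2H :: "(quat^2^2) monoid" where
  "SL2H = \<lparr>carrier = {A. qdet A = 1}, mult = (**), one = mat 1\<rparr>"

lemma qdet_sq_swap: "qdet_sq c d a b = qdet_sq a b c d"
proof -
  have "qRe (c * qcnj a * b * qcnj d) = qRe (qcnj (c * qcnj a * b * qcnj d))"
    by simp
  also have "\<dots> = qRe ((d * qcnj b) * (a * qcnj c))"
    by (simp add: qcnj_mult mult.assoc)
  also have "\<dots> = qRe ((a * qcnj c) * (d * qcnj b))"
    by (rule qRe_commute)
  finally show ?thesis
    unfolding qdet_sq_def by (simp add: mult.assoc)
qed

lemma norm_add_power2: "(norm (p + q))\<^sup>2 = (norm p)\<^sup>2 + (norm q)\<^sup>2 + 2 * qRe (p * qcnj q)" for p q :: quat
  unfolding norm_quat_power2 by (simp add: quat_mult_simps power2_eq_square algebra_simps)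

lemma qcnj_mult_cancel: "p * (qcnj p * q) = (norm p)\<^sup>2 *\<^sub>R q" "qcnj p * (p * q) = (norm p)\<^sup>2 *\<^sub>R q"
  by (simp_all add: mult.assoc [symmetric] mult_qcnj of_real_def)

lemma qdet_sq_add_row2: "qdet_sq a b (c + q * a) (d + q * b) = qdet_sq a b c d"
proof -
  have 1: "qRe (a * qcnj (c + q * a) * (d + q * b) * qcnj b) =
    qRe (a * qcnj c * d * qcnj b) + (norm b)\<^sup>2 * qRe (a * qcnj c * q)
    + (norm a)\<^sup>2 * qRe (qcnj q * d * qcnj b) + (norm a)\<^sup>2 * (norm b)\<^sup>2 * (norm q)\<^sup>2"
    by (simp add: qcnj_add qcnj_mult distrib_left distrib_right mult.assoc mult_qcnj qcnj_mult_cancel of_real_def)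
  have 2: "qRe (c * qcnj (q * a)) = qRe (a * qcnj c * q)"
  proof -
    have "qRe (c * qcnj (q * a)) = qRe (qcnj (c * qcnj (q * a)))"
      by simp
    also have "\<dots> = qRe (q * (a * qcnj c))"
      by (simp add: qcnj_mult mult.assoc)
    also have "\<dots> = qRe (a * qcnj c * q)"
      by (rule qRe_commute)
    finally show ?thesis .
  qed
  have 3: "qRe (d * qcnj (q * b)) = qRe (qcnj q * d * qcnj b)"
  proof -
    have "qRe (d * qcnj (q * b)) = qRe ((d * qcnj b) * qcnj q)"
      by (simp add: qcnj_mult mult.assoc)
    also have "\<dots> = qRe (qcnj q * (d * qcnj b))"
      by (rule qRe_commute)
    finally show ?thesis by (simp add: mult.assoc)
  qed
  show ?thesis
    unfolding qdet_sq_def 1 norm_add_power2 2 3 norm_mult power_mult_distrib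
    by (simp add: algebra_simps)
qed

lemma qdet_sq_add_row1: "qdet_sq (a + q * c) (b + q * d) c d = qdet_sq a b c d"
  using qdet_sq_add_row2[of c d a q b] by (simp add: qdet_sq_swap)

lemma qdet_sq_zero_row: "qdet_sq a b 0 0 = 0" "qdet_sq 0 0 a b = 0"
  by (simp_all add: qdet_sq_def)

lemma qdet_sq_proportional: "qdet_sq a b (q * a) (q * b) = 0"
  using qdet_sq_add_row2[of a b 0 q 0] by (simp add: qdet_sq_zero_row)

lemma qdet_sq_scale: "qdet_sq (p * a) (p * b) (q * c) (q * d) = (norm p)\<^sup>2 * (norm q)\<^sup>2 * qdet_sq a b c d"
proof -
  have "qRe (p * a * qcnj (q * c) * (q * d) * qcnj (p * b))
      = (norm q)\<^sup>2 * qRe (p * (a * qcnj c * d * qcnj b * qcnj p))"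
    by (simp add: qcnj_mult mult.assoc qcnj_mult_cancel)
  also have "\<dots> = (norm q)\<^sup>2 * qRe ((a * qcnj c * d * qcnj b * qcnj p) * p)"
    by (simp add: qRe_commute)
  also have "\<dots> = (norm q)\<^sup>2 * ((norm p)\<^sup>2 * qRe (a * qcnj c * d * qcnj b))"
    by (simp add: mult.assoc mult_qcnj of_real_def)
  finally show ?thesis
    by (simp add: qdet_sq_def norm_mult power_mult_distrib algebra_simps)
qed

lemma qdet_sq_mult:
  "qdet_sq (a * e + b * g) (a * f + b * h) (c * e + d * g) (c * f + d * h)
    = qdet_sq a b c d * qdet_sq e f g h"
proof -
  have nz: "\<exists>k. \<forall>e f g h. qdet_sq (a * e + b * g) (a * f + b * h) (c * e + d * g) (c * f + d * h)
      = k * qdet_sq e f g h" if "a \<noteq> 0" for a b c d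
  proof -
    define q where "q = c * inverse a"
    define s where "s = d - q * b"
    have c: "c = q * a"
      using that by (simp add: q_def mult.assoc)
    have d: "d = s + q * b"
      by (simp add: s_def)
    have "qdet_sq (a * e + b * g) (a * f + b * h) (c * e + d * g) (c * f + d * h)
        = (norm a)\<^sup>2 * (norm s)\<^sup>2 * qdet_sq e f g h" for e f g h
    proof -
      have "qdet_sq (a * e + b * g) (a * f + b * h) (c * e + d * g) (c * f + d * h)
          = qdet_sq (a * e + b * g) (a * f + b * h)
              (s * g + q * (a * e + b * g)) (s * h + q * (a * f + b * h))"
        by (simp add: c d algebra_simps)
      also have "\<dots> = qdet_sq (a * e + b * g) (a * f + b * h) (s * g) (s * h)"
        by (rule qdet_sq_add_row2)
      also have "\<dots> = (norm a)\<^sup>2 * (norm s)\<^sup>2 * qdet_sq e f g h"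
      proof (cases "s = 0")
        case True
        then show ?thesis by (simp add: qdet_sq_zero_row)
      next
        case False
        then have "b * g = (b * inverse s) * (s * g)" "b * h = (b * inverse s) * (s * h)"
          by (simp_all add: mult.assoc) (simp_all add: mult.assoc [symmetric])
        then show ?thesis
          by (metis qdet_sq_add_row1 qdet_sq_scale)
      qed
      finally show ?thesis .
    qed
    then show ?thesis by blast
  qed
  have "\<exists>k. \<forall>e f g h. qdet_sq (a * e + b * g) (a * f + b * h) (c * e + d * g) (c * f + d * h)
      = k * qdet_sq e f g h"
  proof (cases "a = 0")
    case False
    then show ?thesis by (rule nz)
  next
    case a: True
    show ?thesis
    proof (cases "c = 0")
      case False
      then show ?thesis
        using nz[of c d a b] by (metis qdet_sq_swap)
    next
      case c: True
      have "qdet_sq (b * g) (b * h) (d * g) (d * h) = 0" for g h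
        by (metis mult_zero_right qdet_sq_scale qdet_sq_proportional mult_1)
      then show ?thesis
        by (intro exI[of _ 0]) (simp add: a c)
    qed
  qed
  then obtain k where k: "\<And>e f g h.
      qdet_sq (a * e + b * g) (a * f + b * h) (c * e + d * g) (c * f + d * h) = k * qdet_sq e f g h"
    by blast
  have "qdet_sq a b c d = k"
    using k[of 1 0 0 1] by (simp add: qdet_sq_def)
  then show ?thesis
    by (simp add: k)
qed

lemma qdet_mult: "qdet (A ** B) = qdet A * qdet B"
proof -
  have "A ** B = mat2 (A $ 1 $ 1) (A $ 1 $ 2) (A $ 2 $ 1) (A $ 2 $ 2)
      ** mat2 (B $ 1 $ 1) (B $ 1 $ 2) (B $ 2 $ 1) (B $ 2 $ 2)"
    by (simp add: mat2_eta)
  then show ?thesis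
    by (simp add: qdet_def mat2_mult qdet_sq_mult real_sqrt_mult)
qed

lemma qdet_one: "qdet (mat 1) = 1"
  by (simp add: mat2_one qdet_def qdet_sq_def)

lemma SL2H_left_inverse:
  assumes "qdet A = 1"
  shows "\<exists>B. qdet B = 1 \<and> B ** A = mat 1"
proof -
  obtain a b c d where A: "A = mat2 a b c d"
    by (metis mat2_eta)
  have D: "qdet_sq a b c d = 1"
    using assms by (simp add: A qdet_def)
  define B where "B = mat2
    ((norm d)\<^sup>2 *\<^sub>R qcnj a - qcnj c * d * qcnj b) ((norm b)\<^sup>2 *\<^sub>R qcnj c - qcnj a * b * qcnj d)
    ((norm c)\<^sup>2 *\<^sub>R qcnj b - qcnj d * c * qcnj a) ((norm a)\<^sup>2 *\<^sub>R qcnj d - qcnj b * a * qcnj c)"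
  have conj: "p + qcnj p = of_real (2 * qRe p)" for p
    by (simp add: quat_eq_iff of_real_def)
  have re1: "qRe (qcnj c * d * qcnj b * a) = qRe (a * qcnj c * d * qcnj b)"
    using qRe_commute[of "qcnj c * d * qcnj b" a] by (simp add: mult.assoc)
  have re2: "qRe (qcnj b * a * qcnj c * d) = qRe (a * qcnj c * d * qcnj b)"
    using qRe_commute[of "qcnj b" "a * qcnj c * d"] by (simp add: mult.assoc)
  have "B ** A = mat2
    (of_real ((norm a)\<^sup>2 * (norm d)\<^sup>2 + (norm b)\<^sup>2 * (norm c)\<^sup>2)
       - (qcnj c * d * qcnj b * a + qcnj (qcnj c * d * qcnj b * a))) 0
    0 (of_real ((norm a)\<^sup>2 * (norm d)\<^sup>2 + (norm b)\<^sup>2 * (norm c)\<^sup>2)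
       - (qcnj b * a * qcnj c * d + qcnj (qcnj b * a * qcnj c * d)))"
    unfolding A B_def mat2_mult
    by (intro mat2_cong)
      (simp_all add: left_diff_distrib qcnj_mult mult.assoc mult_qcnj qcnj_mult_cancel,
       simp_all add: of_real_def scaleR_add_left mult.commute)
  then have "B ** A = mat2 1 0 0 1"
    using D unfolding conj re1 re2 of_real_diff [symmetric] qdet_sq_def by (simp only: of_real_1)
  moreover from this have "qdet B = 1"
    by (metis assms mat2_one mult_cancel_left1 mult.right_neutral qdet_mult qdet_one)
  ultimately show ?thesis
    by (auto simp: mat2_one)
qed

lemma group_SL2H: "group SL2H"
proof (rule groupI)
  show "\<exists>B\<in>carrier SL2H. B \<otimes>\<^bsub>SL2H\<^esub> A = \<one>\<^bsub>SL2H\<^esub>" if "A \<in> carrier SL2H" for A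
    using SL2H_left_inverse[of A] that by (auto simp: SL2H_def)
qed (simp_all add: SL2H_def qdet_mult qdet_one matrix_mul_assoc)


section \<open>The action on the boundary and its Poincare extension\<close>

datatype qhat = Fin quat | Infty

fun moebius :: "quat^2^2 \<Rightarrow> qhat \<Rightarrow> qhat" where
  "moebius A (Fin z) =
     (let p = A $ 1 $ 1 * z + A $ 1 $ 2; q = A $ 2 $ 1 * z + A $ 2 $ 2
      in if q = 0 then Infty else Fin (p * inverse q))"
| "moebius A Infty =
     (if A $ 2 $ 1 = 0 then Infty else Fin (A $ 1 $ 1 * inverse (A $ 2 $ 1)))"

text \<open>Hyperbolic 5-space in the upper half-space model.\<close>

definition H5 :: "(quat \<times> real) set" where
  "H5 = {(z, t). 0 < t}"

text \<open>
  For \<open>qdet A = 1\<close> the Poincare extension of \<open>z \<mapsto> (a z + b) (c z + d)\<^sup>-\<^sup>1\<close> sends \<open>(z, t)\<close> to the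
  point below; at \<open>t = 0\<close> it specialises to \<^const>\<open>moebius\<close>.
\<close>

definition poincare_ext :: "quat^2^2 \<Rightarrow> quat \<times> real \<Rightarrow> quat \<times> real" where
  "poincare_ext A = (\<lambda>(z, t).
     let a = A $ 1 $ 1; b = A $ 1 $ 2; c = A $ 2 $ 1; d = A $ 2 $ 2;
         r = (norm (c * z + d))\<^sup>2 + (norm c)\<^sup>2 * t\<^sup>2
     in (((a * z + b) * qcnj (c * z + d) + t\<^sup>2 *\<^sub>R (a * qcnj c)) /\<^sub>R r, t / r))"

definition elementary :: "(quat^2^2) set \<Rightarrow> bool" where
  "elementary G \<longleftrightarrow>
     (\<exists>p\<in>H5. finite ((\<lambda>A. poincare_ext A p) ` G)) \<or> (\<exists>w. finite ((\<lambda>A. moebius A w) ` G))"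

definition elliptic :: "quat^2^2 \<Rightarrow> bool" where
  "elliptic A \<longleftrightarrow> (\<exists>p\<in>H5. poincare_ext A p = p)"

text \<open>
  The order of the induced bijection of \<^const>\<open>H5\<close>; as always for \<^const>\<open>group.ord\<close>,
  the value 0 stands for infinite order.
\<close>

definition isometry_ord :: "quat^2^2 \<Rightarrow> nat" where
  "isometry_ord A = group.ord (BijGroup H5) (restrict (poincare_ext A) H5)"

end

theory Submission
  imports Defs
begin

text \<open>
  Write \<open>\<beta>\<close> for the first factor of the hypothesis and \<open>x\<close> for \<open>|bc|\<close>.  Conjugating \<open>T\<close> by \<open>S\<close>
  gives a matrix whose off-diagonal entries satisfy \<open>x' \<le> \<beta> |ad| x \<le> \<beta> (1 + x) x \<le> x\<close>.  If
  \<open>|\<lambda>| \<noteq> |\<mu>|\<close>, two such steps decrease \<open>x\<close> strictly.  Conjugation by powers of \<open>T\<close> leaves \<open>x\<close>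
  unchanged and brings \<open>|b|\<close> into a fixed compact interval, so every value of \<open>x\<close> that occurs is
  attained in a bounded part of the group; that part is finite by discreteness, so \<open>x\<close> has a
  minimum, a contradiction.  The values never reach 0, because a discrete group containing \<open>T\<close> has no
  triangular elements that are not diagonal, and \<open>S\<close> does not preserve \<open>{0, \<infinity>}\<close>.

  Hence \<open>|\<lambda>| = |\<mu>| = 1\<close>, and \<open>T\<close> has finite order by discreteness.  Let \<open>L\<close> and \<open>M\<close> be the complex
  eigenvalues of \<open>\<lambda>\<close> and \<open>\<mu>\<close> with imaginary parts \<open>|\<Im> \<lambda>|\<close> and \<open>-|\<Im> \<mu>|\<close>.  Then
  \<open>\<beta> = |L - M|\<^sup>2\<close>, and if the isometry has order \<open>n\<close> then \<open>L/M\<close> is an \<open>n\<close>-th root of unity whose distance to 1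
  lies strictly between 0 and 1, so \<open>n \<ge> 7\<close>.
\<close>

section \<open>Entries of conjugates\<close>

text \<open>
  The inverse of a matrix \<open>(a, b; c, d)\<close> of determinant 1 has the rows
  \<open>(adj_entry a b c d, adj_entry c d a b)\<close> and \<open>(adj_entry b a d c, adj_entry d c b a)\<close>.
\<close>

definition adj_entry :: "quat \<Rightarrow> quat \<Rightarrow> quat \<Rightarrow> quat \<Rightarrow> quat" where
  "adj_entry a b c d = (norm d)\<^sup>2 *\<^sub>R qcnj a - qcnj c * d * qcnj b"

lemma qdet_sq_swap_cols: "qdet_sq b a d c = qdet_sq a b c d"
proof -
  have "qRe (b * qcnj d * c * qcnj a) = qRe (qcnj (b * qcnj d * c * qcnj a))"
    by simp
  then show ?thesis
    unfolding qdet_sq_def by (simp add: qcnj_mult mult.assoc)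
qed

lemma norm_qcnj [simp]: "norm (qcnj q) = norm q"
  by (simp add: norm_quat_def)

lemma qcnj_scaleR: "qcnj (r *\<^sub>R q) = r *\<^sub>R qcnj q"
  by (simp add: quat_eq_iff)

lemma qcnj_minus: "qcnj (- q) = - qcnj q"
  by (simp add: quat_eq_iff)

text \<open>Expanding the squared norm gives \<open>(norm d)\<^sup>2 * qdet_sq a b c d\<close>;
  swapping rows and columns, which preserves \<open>qdet_sq\<close>, yields the other three.\<close>

lemma norm_adj_entry:
  assumes "qdet_sq a b c d = 1"
  shows "norm (adj_entry a b c d) = norm d"
    and "norm (adj_entry c d a b) = norm b"
    and "norm (adj_entry b a d c) = norm c"
    and "norm (adj_entry d c b a) = norm a"
proof -
  have *: "norm (adj_entry a b c d) = norm d" if "qdet_sq a b c d = 1" for a b c d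
  proof -
    have "qRe ((norm d)\<^sup>2 *\<^sub>R qcnj a * qcnj (- (qcnj c * d * qcnj b)))
        = - ((norm d)\<^sup>2 * qRe (qcnj a * (b * (qcnj d * c))))"
      by (simp add: qcnj_mult qcnj_minus mult.assoc)
    also have "qRe (qcnj a * (b * (qcnj d * c))) = qRe (qcnj (qcnj a * (b * (qcnj d * c))))"
      by simp
    also have "\<dots> = qRe ((qcnj c * d * qcnj b) * a)"
      by (simp add: qcnj_mult mult.assoc)
    also have "\<dots> = qRe (a * (qcnj c * d * qcnj b))"
      by (rule qRe_commute)
    finally have 1: "qRe ((norm d)\<^sup>2 *\<^sub>R qcnj a * qcnj (- (qcnj c * d * qcnj b)))
        = - ((norm d)\<^sup>2 * qRe (a * qcnj c * d * qcnj b))"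
      by (simp add: mult.assoc)
    have "(norm (adj_entry a b c d))\<^sup>2 = (norm d)\<^sup>2 * qdet_sq a b c d"
      using norm_add_power2[of "(norm d)\<^sup>2 *\<^sub>R qcnj a" "- (qcnj c * d * qcnj b)"]
      unfolding adj_entry_def qdet_sq_def 1
      by (simp add: norm_mult power_mult_distrib algebra_simps power2_eq_square)
    then show ?thesis
      using that by simp
  qed
  show "norm (adj_entry a b c d) = norm d" "norm (adj_entry c d a b) = norm b"
    "norm (adj_entry b a d c) = norm c" "norm (adj_entry d c b a) = norm a"
    using assms by (simp_all add: * qdet_sq_swap qdet_sq_swap_cols)
qed

text \<open>The upper right entry of a matrix times its adjugate: the four terms cancel in
  pairs.\<close>

lemma adj_entry_relation: "a * adj_entry c d a b + b * adj_entry d c b a = 0"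
  unfolding adj_entry_def
  by (simp add: right_diff_distrib mult.assoc mult_qcnj qcnj_mult_cancel)

text \<open>Multiply \<open>adj_entry_relation\<close> on the right by
  \<open>qcnj (adj_entry d c b a)\<close> and cancel \<open>a\<close>. This removes the entries of
  the inverse from the mixed term in \<open>conj_off_entry_norm_sq\<close>.\<close>

lemma adj_entry_mult:
  assumes "qdet_sq a b c d = 1"
  shows "adj_entry c d a b * qcnj (adj_entry d c b a) = - (qcnj a * b)"
proof (cases "a = 0")
  case True
  with norm_adj_entry(4)[OF assms] show ?thesis by simp
next
  case False
  have "a * adj_entry c d a b = - (b * adj_entry d c b a)"
    using adj_entry_relation[of a c d b] by (simp add: eq_neg_iff_add_eq_0)
  then have "a * (adj_entry c d a b * qcnj (adj_entry d c b a)) = - (b * (adj_entry d c b a * qcnj (adj_entry d c b a)))"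
    by (metis mult.assoc mult_minus_left)
  also have "\<dots> = - ((norm a)\<^sup>2 *\<^sub>R b)"
    by (simp add: mult_qcnj norm_adj_entry(4)[OF assms] of_real_def)
  also have "\<dots> = a * (- (qcnj a * b))"
    by (simp add: qcnj_mult_cancel)
  finally show ?thesis
    using False by (metis mult_left_cancel)
qed

section \<open>The factor beta and the norms of conjugated entries\<close>

definition jorgensen_const :: "quat \<Rightarrow> quat \<Rightarrow> real" where
  "jorgensen_const l m = (qRe l - qRe m)\<^sup>2 + (norm (qIm l) + norm (qIm m))\<^sup>2"

lemma jorgensen_const_commute: "jorgensen_const m l = jorgensen_const l m"
  by (simp add: jorgensen_const_def power2_eq_square algebra_simps)

lemma norm_qIm_power2: "(norm (qIm q))\<^sup>2 = (norm q)\<^sup>2 - (qRe q)\<^sup>2"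
  by (simp add: norm_quat_power2 qIm_def)

lemma jorgensen_const_eq: "jorgensen_const l m = (norm l)\<^sup>2 + (norm m)\<^sup>2 - 2 * (qRe l * qRe m - norm (qIm l) * norm (qIm m))"
  unfolding jorgensen_const_def power2_sum power2_diff norm_qIm_power2 by (simp add: algebra_simps)

text \<open>Up to the factor \<open>(norm q)\<^sup>2\<close>, conjugation by \<open>q\<close>
  rotates the imaginary part and fixes the real part; Cauchy-Schwarz on imaginary parts does the
  rest. By \<open>jorgensen_const_eq\<close>, beta thus bounds |l - u m u^-1|^2 for all unit
  quaternions u.\<close>

lemma qRe_conj_ge:
  "(norm q)\<^sup>2 * (qRe l * qRe m - norm (qIm l) * norm (qIm m)) \<le> qRe (l * q * qcnj m * qcnj q)"
proof -
  define y where "y = q * qcnj m * qcnj q"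
  have re: "qRe y = (norm q)\<^sup>2 * qRe m"
    unfolding y_def qRe_commute[of "q * qcnj m" "qcnj q"] by (simp add: qcnj_mult_cancel)
  have "(norm (qIm y))\<^sup>2 = ((norm q)\<^sup>2 * norm (qIm m))\<^sup>2"
    unfolding power_mult_distrib norm_qIm_power2 re
    by (simp add: y_def norm_mult power_mult_distrib algebra_simps power2_eq_square)
  then have im: "norm (qIm y) = (norm q)\<^sup>2 * norm (qIm m)"
    by (simp add: power2_eq_iff_nonneg)
  have "inner (qIm l) (qIm y) \<le> norm (qIm l) * norm (qIm y)"
    by (rule norm_cauchy_schwarz)
  moreover have "qRe (l * y) = qRe l * qRe y - inner (qIm l) (qIm y)"
    by (simp add: quat_mult_simps inner_quat_def qIm_def)
  ultimately have "qRe l * qRe y - norm (qIm l) * norm (qIm y) \<le> qRe (l * y)"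
    by simp
  then show ?thesis
    unfolding re im by (simp add: y_def mult.assoc algebra_simps)
qed

text \<open>
  The conjugate of \<open>diag(l, m)\<close> by \<open>(a, b; c, d)\<close> has upper row
  \<open>(conj_diag_entry a b c d l m, conj_off_entry a b c d l m)\<close>; the lower row arises by reversing
  \<open>a, b, c, d\<close> and \<open>l, m\<close>.
\<close>

definition conj_diag_entry :: "quat \<Rightarrow> quat \<Rightarrow> quat \<Rightarrow> quat \<Rightarrow> quat \<Rightarrow> quat \<Rightarrow> quat" where
  "conj_diag_entry a b c d l m = a * l * adj_entry a b c d + b * m * adj_entry b a d c"

definition conj_off_entry :: "quat \<Rightarrow> quat \<Rightarrow> quat \<Rightarrow> quat \<Rightarrow> quat \<Rightarrow> quat \<Rightarrow> quat" where
  "conj_off_entry a b c d l m = a * l * adj_entry c d a b + b * m * adj_entry d c b a"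

text \<open>The mixed term is rewritten by cyclicity of the real part and
  \<open>adj_entry_mult\<close>, the source of the minus sign.\<close>

lemma conj_off_entry_norm_sq:
  assumes "qdet_sq a b c d = 1"
  shows "(norm (conj_off_entry a b c d l m))\<^sup>2 = (norm a)\<^sup>2 * (norm b)\<^sup>2 * ((norm l)\<^sup>2 + (norm m)\<^sup>2)
    - 2 * qRe (l * (qcnj a * b) * qcnj m * qcnj (qcnj a * b))"
proof -
  have "qRe (a * l * adj_entry c d a b * qcnj (b * m * adj_entry d c b a))
      = qRe (a * (l * (adj_entry c d a b * qcnj (adj_entry d c b a)) * qcnj m * qcnj b))"
    by (simp add: qcnj_mult mult.assoc)
  also have "\<dots> = qRe ((l * (adj_entry c d a b * qcnj (adj_entry d c b a)) * qcnj m * qcnj b) * a)"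
    by (rule qRe_commute)
  finally have "qRe (a * l * adj_entry c d a b * qcnj (b * m * adj_entry d c b a))
      = - qRe (l * (qcnj a * b) * qcnj m * qcnj (qcnj a * b))"
    unfolding adj_entry_mult[OF assms] by (simp add: qcnj_mult mult.assoc)
  then show ?thesis
    unfolding conj_off_entry_def norm_add_power2
    by (simp add: norm_mult power_mult_distrib norm_adj_entry[OF assms] algebra_simps)
qed

lemma conj_off_entry_norm_le:
  assumes "qdet_sq a b c d = 1"
  shows "(norm (conj_off_entry a b c d l m))\<^sup>2 \<le> jorgensen_const l m * ((norm a)\<^sup>2 * (norm b)\<^sup>2)"
  using qRe_conj_ge[of "qcnj a * b" l m] unfolding conj_off_entry_norm_sq[OF assms] jorgensen_const_eq
  by (simp add: norm_mult power_mult_distrib algebra_simps)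

text \<open>For \<open>norm l \<noteq> norm m\<close>, the off-diagonal entry can therefore vanish
  only if \<open>a\<close> or \<open>b\<close> does.\<close>

lemma conj_off_entry_norm_ge:
  assumes "qdet_sq a b c d = 1"
  shows "norm a * norm b * \<bar>norm l - norm m\<bar> \<le> norm (conj_off_entry a b c d l m)"
proof -
  have "\<bar>norm (a * l * adj_entry c d a b) - norm (b * m * adj_entry d c b a)\<bar> \<le> norm (conj_off_entry a b c d l m)"
    unfolding conj_off_entry_def using norm_triangle_ineq3[of "a * l * adj_entry c d a b" "- (b * m * adj_entry d c b a)"]
    by simp
  moreover have "norm (a * l * adj_entry c d a b) - norm (b * m * adj_entry d c b a) = norm a * norm b * (norm l - norm m)"
    by (simp add: norm_mult norm_adj_entry[OF assms] algebra_simps)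
  ultimately show ?thesis
    by (simp add: abs_mult)
qed

lemma conj_diag_entry_norm_le:
  assumes "qdet_sq a b c d = 1"
  shows "norm (conj_diag_entry a b c d l m) \<le> norm a * norm d * norm l + norm b * norm c * norm m"
  unfolding conj_diag_entry_def
  by (rule order_trans[OF norm_triangle_ineq]) (simp add: norm_mult norm_adj_entry[OF assms])

lemma abs_qRe_le_norm: "\<bar>qRe q\<bar> \<le> norm q"
  unfolding norm_quat_def real_sqrt_abs [symmetric] by (intro real_sqrt_le_mono) simp

lemma eq_of_real_norm:
  assumes "qRe q = norm q"
  shows "q = of_real (norm q)"
proof -
  have "(qI q)\<^sup>2 + ((qJ q)\<^sup>2 + (qK q)\<^sup>2) = 0"
    using norm_quat_power2[of q] assms by simp
  then have "qI q = 0" "qJ q = 0" "qK q = 0"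
    by (simp_all add: add_nonneg_eq_0_iff)
  then show ?thesis
    by (simp add: quat_eq_iff of_real_def assms)
qed

text \<open>With K = \<open>a * qcnj c * d * qcnj b\<close>, the determinant condition reads (|ad| -
  |bc|)^2 + 2 (|K| - Re K) = 1 with both summands nonnegative. Equality forces Re K = |K|, so K is
  real.\<close>

lemma norm_ad_le:
  assumes "qdet_sq a b c d = 1"
  shows "norm a * norm d \<le> 1 + norm b * norm c"
    and "norm a * norm d = 1 + norm b * norm c \<Longrightarrow>
      a * qcnj c * d * qcnj b = of_real (norm a * norm d * (norm b * norm c))"
proof -
  let ?K = "a * qcnj c * d * qcnj b"
  have nK: "norm ?K = norm a * norm d * (norm b * norm c)"
    by (simp add: norm_mult)
  have le: "qRe ?K \<le> norm a * norm d * (norm b * norm c)"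
    using abs_qRe_le_norm[of ?K] unfolding nK by simp
  have D: "(norm a * norm d)\<^sup>2 + (norm b * norm c)\<^sup>2 - 2 * qRe ?K = 1"
    using assms by (simp add: qdet_sq_def power_mult_distrib)
  have "(norm a * norm d - norm b * norm c)\<^sup>2 \<le> 1"
    unfolding power2_diff using D le by linarith
  then have "norm a * norm d - norm b * norm c \<le> 1"
    by (metis abs_le_square_iff abs_one one_power2 abs_le_D1)
  then show "norm a * norm d \<le> 1 + norm b * norm c" by simp
  assume eq: "norm a * norm d = 1 + norm b * norm c"
  then have "(norm a * norm d - norm b * norm c)\<^sup>2 = 1" by simp
  then have re: "qRe ?K = norm a * norm d * (norm b * norm c)"
    unfolding power2_diff using D by linarith
  then show "?K = of_real (norm a * norm d * (norm b * norm c))"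
    using eq_of_real_norm[of ?K] unfolding nK by simp
qed

text \<open>
  In the equality case \<open>a * qcnj c * d * qcnj b\<close> is a positive real, which makes the entries of the
  inverse real multiples of the conjugates of \<open>a\<close> and \<open>b\<close>.  The mixed term in the norm of the
  diagonal entry is then read off from the norm of the off-diagonal one.
\<close>

lemma conj_diag_entry_norm_extremal:
  assumes D: "qdet_sq a b c d = 1" and nz: "a \<noteq> 0" "b \<noteq> 0"
    and x: "x = norm b * norm c" and ad: "norm a * norm d = 1 + x"
    and ext: "(norm (conj_off_entry a b c d l m))\<^sup>2 = jorgensen_const l m * ((norm a)\<^sup>2 * (norm b)\<^sup>2)"
    and jb: "jorgensen_const l m * (1 + x) = 1"
  shows "(norm (conj_diag_entry a b c d l m))\<^sup>2 = (1 + x) * (norm l)\<^sup>2 - x * (norm m)\<^sup>2 + x"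
proof -
  have K: "a * qcnj c * d * qcnj b = of_real ((1 + x) * x)"
    using norm_ad_le(2)[OF D] ad x by simp
  have Da: "(norm a)\<^sup>2 * (norm d)\<^sup>2 = (1 + x)\<^sup>2" and Db: "(norm b)\<^sup>2 * (norm c)\<^sup>2 = x\<^sup>2"
    using ad x by (simp_all add: power_mult_distrib [symmetric])
  \<comment> \<open>The factor \<open>(norm a)\<^sup>2 = qcnj a * a\<close> completes the product
    inside \<open>adj_entry a b c d\<close> to the known real number of \<open>K\<close>, with no
    division by \<open>a\<close>.\<close>
  have "(norm a)\<^sup>2 *\<^sub>R adj_entry a b c d = (norm a)\<^sup>2 *\<^sub>R ((norm d)\<^sup>2 *\<^sub>R qcnj a) - qcnj a * (a * qcnj c * d * qcnj b)"
    by (simp add: adj_entry_def scaleR_diff_right mult.assoc qcnj_mult_cancel)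
  also have "\<dots> = ((1 + x)\<^sup>2 - (1 + x) * x) *\<^sub>R qcnj a"
    unfolding K scaleR_scaleR Da by (simp add: of_real_def scaleR_diff_left)
  also have "(1 + x)\<^sup>2 - (1 + x) * x = 1 + x"
    by (simp add: power2_eq_square algebra_simps)
  finally have A: "(norm a)\<^sup>2 *\<^sub>R adj_entry a b c d = (1 + x) *\<^sub>R qcnj a" .
  have K': "b * qcnj d * c * qcnj a = of_real ((1 + x) * x)"
  proof -
    have "b * qcnj d * c * qcnj a = qcnj (a * qcnj c * d * qcnj b)"
      by (simp add: qcnj_mult mult.assoc)
    also have "\<dots> = of_real ((1 + x) * x)"
      unfolding K by (simp only: quat_eq_iff) (simp add: of_real_def)
    finally show ?thesis .
  qed
  have "(norm b)\<^sup>2 *\<^sub>R adj_entry b a d c = (norm b)\<^sup>2 *\<^sub>R ((norm c)\<^sup>2 *\<^sub>R qcnj b) - qcnj b * (b * qcnj d * c * qcnj a)"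
    by (simp add: adj_entry_def scaleR_diff_right mult.assoc qcnj_mult_cancel)
  also have "\<dots> = (x\<^sup>2 - (1 + x) * x) *\<^sub>R qcnj b"
    unfolding K' scaleR_scaleR Db by (simp add: of_real_def scaleR_diff_left)
  also have "x\<^sup>2 - (1 + x) * x = - x"
    by (simp add: power2_eq_square algebra_simps)
  finally have B: "(norm b)\<^sup>2 *\<^sub>R adj_entry b a d c = (- x) *\<^sub>R qcnj b" .
  \<comment> \<open>\<open>V\<close> is the mixed term in the norm of the diagonal entry,
    \<open>W\<close> the negated one of the off-diagonal entry. Extremality determines
    \<open>W\<close>, and \<open>A\<close>, \<open>B\<close> transfer it to
    \<open>V\<close>.\<close>
  define W where "W = qRe (l * (qcnj a * b) * qcnj m * qcnj (qcnj a * b))"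
  define V where "V = qRe (a * l * adj_entry a b c d * qcnj (b * m * adj_entry b a d c))"
  have "V = qRe (a * (l * (adj_entry a b c d * qcnj (adj_entry b a d c)) * qcnj m * qcnj b))"
    by (simp add: V_def qcnj_mult mult.assoc)
  also have "\<dots> = qRe ((l * (adj_entry a b c d * qcnj (adj_entry b a d c)) * qcnj m * qcnj b) * a)"
    by (rule qRe_commute)
  finally have "(norm a)\<^sup>2 * (norm b)\<^sup>2 * V
      = qRe (l * (((norm a)\<^sup>2 *\<^sub>R adj_entry a b c d) * qcnj ((norm b)\<^sup>2 *\<^sub>R adj_entry b a d c)) * qcnj m * qcnj b * a)"
    by (simp add: qcnj_scaleR)
  also have "\<dots> = - ((1 + x) * x * W)"
    unfolding A B W_def qcnj_scaleR by (simp add: qcnj_mult mult.assoc)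
  finally have VW: "(norm a)\<^sup>2 * (norm b)\<^sup>2 * V = - ((1 + x) * x * W)" .
  have "2 * W = (norm a)\<^sup>2 * (norm b)\<^sup>2 * ((norm l)\<^sup>2 + (norm m)\<^sup>2 - jorgensen_const l m)"
    using ext unfolding conj_off_entry_norm_sq[OF D] W_def by (simp add: algebra_simps)
  moreover have "(norm a)\<^sup>2 * (norm b)\<^sup>2 * (2 * V) = - ((1 + x) * x * (2 * W))"
    using arg_cong[OF VW, of "\<lambda>z. 2 * z"] by (simp only: mult.left_commute[of _ 2] mult_minus_right)
  ultimately have "(norm a)\<^sup>2 * (norm b)\<^sup>2 * (2 * V)
      = (norm a)\<^sup>2 * (norm b)\<^sup>2 * (- ((1 + x) * x * ((norm l)\<^sup>2 + (norm m)\<^sup>2 - jorgensen_const l m)))"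
    by (simp only: mult.left_commute mult_minus_right)
  then have V: "2 * V = - ((1 + x) * x * ((norm l)\<^sup>2 + (norm m)\<^sup>2 - jorgensen_const l m))"
    by (rule mult_left_cancel[THEN iffD1, rotated]) (use nz in simp)
  have "(norm (conj_diag_entry a b c d l m))\<^sup>2 = (1 + x)\<^sup>2 * (norm l)\<^sup>2 + x\<^sup>2 * (norm m)\<^sup>2 + 2 * V"
    unfolding conj_diag_entry_def norm_add_power2 V_def Da[symmetric] Db[symmetric]
    by (simp add: norm_mult power_mult_distrib norm_adj_entry[OF D])
  also have "\<dots> = (1 + x) * (norm l)\<^sup>2 - x * (norm m)\<^sup>2 + x * (jorgensen_const l m * (1 + x))"
    unfolding V by (simp add: power2_eq_square algebra_simps)
  finally show ?thesis
    by (simp add: jb)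
qed

section \<open>Descent of the off-diagonal product\<close>

lemma conj_off_entry_prod_le:
  assumes D: "qdet_sq a b c d = 1"
  shows "norm (conj_off_entry a b c d l m) * norm (conj_off_entry d c b a m l)
    \<le> jorgensen_const l m * (norm a * norm d) * (norm b * norm c)"
proof (rule power2_le_imp_le)
  have D': "qdet_sq d c b a = 1"
    using D by (simp add: qdet_sq_swap qdet_sq_swap_cols)
  have "(norm (conj_off_entry a b c d l m))\<^sup>2 * (norm (conj_off_entry d c b a m l))\<^sup>2
      \<le> (jorgensen_const l m * ((norm a)\<^sup>2 * (norm b)\<^sup>2)) * (jorgensen_const l m * ((norm d)\<^sup>2 * (norm c)\<^sup>2))"
    using conj_off_entry_norm_le[OF D, of l m] conj_off_entry_norm_le[OF D', of m l]
    by (intro mult_mono) (auto simp: jorgensen_const_commute jorgensen_const_def)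
  then show "(norm (conj_off_entry a b c d l m) * norm (conj_off_entry d c b a m l))\<^sup>2
      \<le> (jorgensen_const l m * (norm a * norm d) * (norm b * norm c))\<^sup>2"
    by (simp add: power_mult_distrib power2_eq_square ac_simps)
qed (simp add: jorgensen_const_def)

text \<open>
  One conjugation need not decrease \<open>norm b * norm c\<close> strictly, but two do: if the first does not, the
  diagonal entries \<open>a', d'\<close> satisfy, with \<open>N = (norm l)\<^sup>2 + (norm m)\<^sup>2 > 2\<close>,
  \<open>(norm a' * norm d')\<^sup>2 = (1 + x)\<^sup>2 + x * (N - 2) * (1 - (1 + x) * (N + 2))\<close>,
  which is smaller than the value \<open>(1 + x)\<^sup>2\<close> required for equality in the second step.
\<close>

lemma conj_off_entry_prod_descent:
  assumes D: "qdet_sq a b c d = 1"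
    and bc: "b \<noteq> 0" "c \<noteq> 0"
    and jb: "jorgensen_const l m * (1 + norm b * norm c) \<le> 1"
    and lm: "norm l * norm m = 1" "norm l \<noteq> norm m"
    and a': "a' = conj_diag_entry a b c d l m" and b': "b' = conj_off_entry a b c d l m"
    and c': "c' = conj_off_entry d c b a m l" and d': "d' = conj_diag_entry d c b a m l"
    and D': "qdet_sq a' b' c' d' = 1"
  shows "norm b' * norm c' \<le> norm b * norm c"
    and "norm (conj_off_entry a' b' c' d' l m) * norm (conj_off_entry d' c' b' a' m l) < norm b * norm c"
proof -
  define \<beta> where "\<beta> = jorgensen_const l m"
  define x where "x = norm b * norm c"
  define y where "y = norm a * norm d"
  define x' where "x' = norm b' * norm c'"
  define y' where "y' = norm a' * norm d'"
  define x'' where "x'' = norm (conj_off_entry a' b' c' d' l m) * norm (conj_off_entry d' c' b' a' m l)"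
  have x: "x > 0"
    using bc by (simp add: x_def)
  have x': "x' \<ge> 0"
    by (simp add: x'_def)
  have \<beta>: "\<beta> \<ge> 0"
    by (simp add: \<beta>_def jorgensen_const_def)
  have \<beta>x: "\<beta> * (1 + x) \<le> 1"
    using jb by (simp add: \<beta>_def x_def)
  have y: "y \<le> 1 + x"
    using norm_ad_le(1)[OF D] by (simp add: x_def y_def)
  have y': "y' \<le> 1 + x'"
    using norm_ad_le(1)[OF D'] by (simp add: x'_def y'_def)
  have 1: "x' \<le> \<beta> * y * x"
    using conj_off_entry_prod_le[OF D, of l m] by (simp add: \<beta>_def x_def y_def x'_def b' c')
  have 2: "x'' \<le> \<beta> * y' * x'"
    using conj_off_entry_prod_le[OF D', of l m] by (simp add: \<beta>_def x'_def y'_def x''_def)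
  have \<beta>y: "\<beta> * y \<le> 1"
    using mult_left_mono[OF y \<beta>] \<beta>x by linarith
  have x'x: "x' \<le> x"
    using 1 mult_right_mono[OF \<beta>y less_imp_le[OF x]] by linarith
  have \<beta>y': "\<beta> * y' \<le> 1"
    using mult_left_mono[OF y' \<beta>] mult_left_mono[of "1 + x'" "1 + x" \<beta>] \<beta> x'x \<beta>x by simp
  have x''x': "x'' \<le> x'"
    using 2 mult_right_mono[OF \<beta>y' x'] by linarith
  show "norm b' * norm c' \<le> norm b * norm c"
    using x'x by (simp add: x_def x'_def)
  have "x'' < x"
  proof (rule ccontr)
    assume "\<not> x'' < x"
    \<comment> \<open>Both steps are now equalities, which forces
      \<open>\<beta> * (1 + x) = 1\<close> and puts \<open>y\<close> and \<open>y'\<close> at their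
      maximum \<open>1 + x\<close>.\<close>
    then have xs: "x' = x" "x'' = x"
      using x'x x''x' by linarith+
    have "1 \<le> \<beta> * y" "1 \<le> \<beta> * y'"
      using 1 2 x unfolding xs by simp_all
    then have \<beta>y1: "\<beta> * y = 1" "\<beta> * y' = 1"
      using \<beta>y \<beta>y' by simp_all
    then have \<beta>0: "\<beta> > 0"
      using \<beta> by (metis less_eq_real_def mult_zero_left zero_neq_one)
    have \<beta>x1: "\<beta> * (1 + x) = 1"
      using \<beta>x \<beta>y1 mult_left_mono[OF y \<beta>] by linarith
    then have "\<beta> * y = \<beta> * (1 + x)" "\<beta> * y' = \<beta> * (1 + x)"
      using \<beta>y1 by simp_all
    then have ys: "y = 1 + x" "y' = 1 + x"
      using \<beta>0 by simp_all
    then have nz: "a \<noteq> 0" "d \<noteq> 0"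
      using x by (auto simp: y_def)
    have E: "qdet_sq d c b a = 1"
      using D by (simp add: qdet_sq_swap qdet_sq_swap_cols)
    \<comment> \<open>\<open>A\<close> and \<open>B\<close> bound the squared norms of
      \<open>b'\<close> and \<open>c'\<close>. The product of the bounds is attained, hence so is
      each of them, as \<open>conj_diag_entry_norm_extremal\<close> requires.\<close>
    define A where "A = \<beta> * ((norm a)\<^sup>2 * (norm b)\<^sup>2)"
    define B where "B = \<beta> * ((norm d)\<^sup>2 * (norm c)\<^sup>2)"
    have AB: "A > 0" "B > 0"
      using nz bc \<beta>0 by (simp_all add: A_def B_def)
    have P: "(norm b')\<^sup>2 \<le> A" and Q: "(norm c')\<^sup>2 \<le> B"
      using conj_off_entry_norm_le[OF D, of l m] conj_off_entry_norm_le[OF E, of m l]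
      by (simp_all add: A_def B_def b' c' \<beta>_def jorgensen_const_commute)
    have "A * B = (\<beta> * y * x)\<^sup>2"
      by (simp add: A_def B_def x_def y_def power_mult_distrib) (simp add: power2_eq_square)
    also have "\<dots> = (norm b')\<^sup>2 * (norm c')\<^sup>2"
      using xs(1) by (simp add: \<beta>y1 x'_def power_mult_distrib [symmetric])
    finally have PQ: "A * B = (norm b')\<^sup>2 * (norm c')\<^sup>2" .
    have PA: "(norm b')\<^sup>2 = A"
    proof (rule antisym[OF P])
      have "A * B \<le> (norm b')\<^sup>2 * B"
        unfolding PQ using Q by (intro mult_left_mono) auto
      then show "A \<le> (norm b')\<^sup>2"
        using AB by simp
    qed
    have QB: "(norm c')\<^sup>2 = B"
      using PQ AB unfolding PA by simp
    define u where "u = (norm l)\<^sup>2"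
    define v where "v = (norm m)\<^sup>2"
    have uv: "u * v = 1"
      using lm by (simp add: u_def v_def power_mult_distrib [symmetric])
    have "(norm a')\<^sup>2 = (1 + x) * u - x * v + x"
      unfolding a' u_def v_def
      using PA \<beta>x1 ys by (intro conj_diag_entry_norm_extremal[OF D nz(1) bc(1) x_def])
        (simp_all add: y_def A_def b' \<beta>_def)
    moreover have "(norm d')\<^sup>2 = (1 + x) * v - x * u + x"
      unfolding d' u_def v_def
      using QB \<beta>x1 ys by (intro conj_diag_entry_norm_extremal[OF E nz(2) bc(2)])
        (simp_all add: x_def y_def B_def c' \<beta>_def jorgensen_const_commute mult.commute)
    ultimately have "(1 + x)\<^sup>2 = ((1 + x) * u - x * v + x) * ((1 + x) * v - x * u + x)"
      using ys(2) by (metis power_mult_distrib y'_def)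
    \<comment> \<open>A polynomial identity in \<open>u\<close>, \<open>v\<close>, \<open>x\<close>;
      the last summand vanishes because \<open>u * v = 1\<close>.\<close>
    also have "\<dots> = (1 + x)\<^sup>2 + x * ((u + v - 2) * (1 - (1 + x) * (u + v + 2)))
        + (1 + 2 * x)\<^sup>2 * (u * v - 1)"
      by (simp add: power2_eq_square algebra_simps)
    finally have "(u + v - 2) * (1 - (1 + x) * (u + v + 2)) = 0"
      using x uv by simp
    moreover have "u + v - 2 > 0"
    proof -
      have "u + v - 2 = (norm l - norm m)\<^sup>2"
        using lm by (simp add: u_def v_def power2_diff)
      then show ?thesis
        using lm by simp
    qed
    moreover have "1 - (1 + x) * (u + v + 2) < 0"
    proof -
      have uv0: "u \<ge> 0" "v \<ge> 0"
        by (simp_all add: u_def v_def)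
      then have "1 < 1 * (u + v + 2)"
        by simp
      also have "\<dots> \<le> (1 + x) * (u + v + 2)"
        using x uv0 by (intro mult_right_mono) auto
      finally show ?thesis
        by simp
    qed
    ultimately show False by simp
  qed
  then show "norm (conj_off_entry a' b' c' d' l m) * norm (conj_off_entry d' c' b' a' m l) < norm b * norm c"
    by (simp add: x_def x''_def)
qed

section \<open>Inverses and conjugation in SL(2,H)\<close>

lemma mat2_in_SL2H: "mat2 a b c d \<in> carrier SL2H \<longleftrightarrow> qdet_sq a b c d = 1"
  by (simp add: SL2H_def qdet_def)

lemma mult_SL2H: "A \<otimes>\<^bsub>SL2H\<^esub> B = A ** B"
  by (simp add: SL2H_def)

lemma one_SL2H: "\<one>\<^bsub>SL2H\<^esub> = mat2 1 0 0 1"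
  by (simp add: SL2H_def mat2_one)

text \<open>The subtracted products add up to \<open>?K + qcnj ?K\<close>, twice a real part, so the
  sum is \<open>qdet_sq a b c d\<close>.\<close>

lemma adj_entry_det:
  assumes "qdet_sq a b c d = 1"
  shows "a * adj_entry a b c d + b * adj_entry b a d c = 1"
proof -
  let ?K = "a * qcnj c * d * qcnj b"
  have "a * adj_entry a b c d + b * adj_entry b a d c
      = of_real ((norm a)\<^sup>2 * (norm d)\<^sup>2 + (norm b)\<^sup>2 * (norm c)\<^sup>2) - (?K + qcnj ?K)"
    unfolding adj_entry_def
    by (simp add: right_diff_distrib qcnj_mult mult.assoc mult_qcnj)
      (simp add: of_real_def mult.commute scaleR_add_left)
  also have "?K + qcnj ?K = of_real (2 * qRe ?K)"
    by (simp add: quat_eq_iff of_real_def)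
  also have "of_real ((norm a)\<^sup>2 * (norm d)\<^sup>2 + (norm b)\<^sup>2 * (norm c)\<^sup>2) - of_real (2 * qRe ?K)
      = (of_real (qdet_sq a b c d) :: quat)"
    unfolding qdet_sq_def by (simp only: of_real_diff)
  finally show ?thesis
    using assms by simp
qed

lemma inv_SL2H:
  assumes D: "qdet_sq a b c d = 1"
  shows "inv\<^bsub>SL2H\<^esub> (mat2 a b c d) = mat2 (adj_entry a b c d) (adj_entry c d a b) (adj_entry b a d c) (adj_entry d c b a)"
    (is "_ = ?B")
proof -
  interpret SL: group SL2H by (rule group_SL2H)
  have E: "qdet_sq d c b a = 1"
    using D by (simp add: qdet_sq_swap qdet_sq_swap_cols)
  have r: "mat2 a b c d ** ?B = mat2 1 0 0 1"
    using adj_entry_det[OF D] adj_entry_det[OF E] adj_entry_relation[of a c d b] adj_entry_relation[of d b a c]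
    by (simp add: mat2_mult add.commute)
  moreover have "qdet (mat2 a b c d) = 1"
    using D by (simp add: qdet_def)
  ultimately have "qdet ?B = 1"
    by (metis mat2_one mult_1 qdet_mult qdet_one)
  then have B: "?B \<in> carrier SL2H"
    by (simp add: SL2H_def)
  have "mat2 a b c d \<in> carrier SL2H"
    using D by (simp add: mat2_in_SL2H)
  with r B show ?thesis
    by (metis SL.inv_equality SL.inv_comm mult_SL2H one_SL2H)
qed

lemma conj_mat2:
  assumes "qdet_sq a b c d = 1"
  shows "mat2 a b c d \<otimes>\<^bsub>SL2H\<^esub> mat2 l 0 0 m \<otimes>\<^bsub>SL2H\<^esub> inv\<^bsub>SL2H\<^esub> (mat2 a b c d)
    = mat2 (conj_diag_entry a b c d l m) (conj_off_entry a b c d l m) (conj_off_entry d c b a m l) (conj_diag_entry d c b a m l)"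
  unfolding inv_SL2H[OF assms] mult_SL2H mat2_mult conj_diag_entry_def conj_off_entry_def
  by (intro mat2_cong) (simp_all add: add.commute)

lemma qdet_sq_diag: "qdet_sq p 0 0 s = (norm p * norm s)\<^sup>2"
  by (simp add: qdet_sq_def power_mult_distrib)

lemma diag_norm_prod:
  assumes G: "subgroup G SL2H" and P: "mat2 p 0 0 s \<in> G"
  shows "norm p * norm s = 1"
proof -
  have "qdet_sq p 0 0 s = 1"
    using P subgroup.mem_carrier[OF G] mat2_in_SL2H by blast
  then show ?thesis
    by (simp add: qdet_sq_diag power2_eq_1_iff) (smt (verit) mult_nonneg_nonneg norm_ge_zero)
qed

text \<open>The inverse of diag(p, s) has diagonal norms |s| and |p|: \<open>b\<close> picks up |p|
  twice and \<open>c\<close> picks up |s| twice, while |p||s| = 1 preserves the norms of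
  \<open>a\<close> and \<open>d\<close>.\<close>

lemma conj_diag:
  assumes G: "subgroup G SL2H" and P: "mat2 p 0 0 s \<in> G" and A: "mat2 a b c d \<in> G"
  shows "\<exists>a' b' c' d'. mat2 a' b' c' d' \<in> G \<and> norm a' = norm a \<and> norm d' = norm d
    \<and> norm b' = norm b * (norm p)\<^sup>2 \<and> norm c' = norm c * (norm s)\<^sup>2"
proof -
  have D: "qdet_sq p 0 0 s = 1"
    using P subgroup.mem_carrier[OF G] mat2_in_SL2H by blast
  have ps: "norm p * norm s = 1"
    by (rule diag_norm_prod[OF G P])
  have "mat2 p 0 0 s \<otimes>\<^bsub>SL2H\<^esub> mat2 a b c d \<otimes>\<^bsub>SL2H\<^esub> inv\<^bsub>SL2H\<^esub> (mat2 p 0 0 s) \<in> G"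
    using G P A by (simp add: subgroup.m_closed subgroup.m_inv_closed)
  moreover have "mat2 p 0 0 s \<otimes>\<^bsub>SL2H\<^esub> mat2 a b c d \<otimes>\<^bsub>SL2H\<^esub> inv\<^bsub>SL2H\<^esub> (mat2 p 0 0 s)
    = mat2 (p * a * adj_entry p 0 0 s) (p * b * adj_entry s 0 0 p) (s * c * adj_entry p 0 0 s) (s * d * adj_entry s 0 0 p)"
    unfolding inv_SL2H[OF D] mult_SL2H mat2_mult by (simp add: adj_entry_def)
  moreover have "norm (adj_entry p 0 0 s) = norm s" "norm (adj_entry s 0 0 p) = norm p"
    using norm_adj_entry(1,4)[OF D] by simp_all
  moreover have "norm p * norm a * norm s = norm a" "norm s * norm d * norm p = norm d"
    using ps by (metis mult.assoc mult.commute mult_1)+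
  ultimately show ?thesis
    by (intro exI[of _ "p * a * adj_entry p 0 0 s"] exI[of _ "p * b * adj_entry s 0 0 p"]
        exI[of _ "s * c * adj_entry p 0 0 s"] exI[of _ "s * d * adj_entry s 0 0 p"] conjI)
      (simp_all add: norm_mult power2_eq_square)
qed

section \<open>Discrete subgroups\<close>

text \<open>Finite dimension makes Bolzano-Weierstrass available for
  \<open>quat^2^2\<close>.\<close>

instantiation quat :: euclidean_space
begin

definition "Basis = {Quat 1 0 0 0, Quat 0 1 0 0, Quat 0 0 1 0, Quat 0 0 0 1}"

instance
proof
  show "(\<forall>u\<in>Basis. inner x u = 0) \<longleftrightarrow> x = 0" for x :: quat
    by (simp add: Basis_quat_def inner_quat_def quat_eq_iff[of x])
qed (auto simp: Basis_quat_def inner_quat_def)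

end

lemma norm_mat2_le:
  fixes X :: "quat^2^2"
  assumes "\<And>i j. norm (X $ i $ j) \<le> r"
  shows "norm X \<le> 4 * r"
proof -
  have row: "norm (X $ i) \<le> 2 * r" for i
    using L2_set_le_sum[of UNIV "\<lambda>j. norm (X $ i $ j)"] assms[of i 1] assms[of i 2]
    by (simp add: norm_vec_def sum_2)
  show ?thesis
    using L2_set_le_sum[of UNIV "\<lambda>i. norm (X $ i)"] row[of 1] row[of 2]
    by (simp add: norm_vec_def[of X] sum_2)
qed

lemma norm_entry_le:
  fixes X :: "quat^2^2"
  shows "norm (X $ i $ j) \<le> norm X"
  by (rule order_trans[OF Finite_Cartesian_Product.norm_nth_le Finite_Cartesian_Product.norm_nth_le])

text \<open>An infinite bounded part would have a limit point, possibly outside \<open>G\<close>.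
  Two distinct elements A, B near it make A^-1 B close to the identity, since the entries of A^-1
  obey the same bound; this contradicts isolation of the identity.\<close>

lemma discrete_subgroup_bounded_finite:
  assumes G: "subgroup G SL2H" and disc: "discrete G"
  shows "finite {A \<in> G. \<forall>i j. norm (A $ i $ j) \<le> R}" (is "finite ?F")
proof (rule ccontr)
  assume inf: "infinite ?F"
  interpret SL: group SL2H by (rule group_SL2H)
  have "\<forall>A\<in>?F. norm A \<le> 4 * R"
    by (auto intro: norm_mat2_le)
  then have "bounded ?F"
    unfolding bounded_iff by blast
  with inf obtain L where L: "L islimpt ?F"
    using bounded_infinite_imp_islimpt[of ?F ?F] by blast
  have "mat 1 \<in> G"
    using subgroup.one_closed[OF G] by (simp add: SL2H_def)
  then obtain e where e: "e > 0" "\<And>A. A \<in> G \<Longrightarrow> dist (mat 1) A < e \<Longrightarrow> A = mat 1"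
    using discreteD[OF disc] isolated_in_dist_Ex_iff by metis
  obtain A0 where "A0 \<in> ?F"
    using inf by (metis (no_types, lifting) finite.emptyI equals0I)
  then have R: "R \<ge> 0"
    using norm_ge_zero order_trans by blast
  \<comment> \<open>Chosen so that \<open>4 * (4 * R * \<delta>) < e\<close>, also for
    \<open>R = 0\<close>.\<close>
  define \<delta> where "\<delta> = e / (16 * (R + 1))"
  have \<delta>: "\<delta> > 0"
    using e R by (simp add: \<delta>_def)
  obtain A where A: "A \<in> ?F" "A \<noteq> L" "dist A L < \<delta>"
    using L \<delta> unfolding islimpt_approachable by blast
  then have "min \<delta> (dist A L) > 0"
    using \<delta> by simp
  \<comment> \<open>Being strictly closer to \<open>L\<close> than \<open>A\<close> is,
    \<open>B\<close> differs from \<open>A\<close>.\<close>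
  then obtain B where B: "B \<in> ?F" "dist B L < min \<delta> (dist A L)"
    using L unfolding islimpt_approachable by blast
  then have "A \<noteq> B"
    by auto
  have AB: "norm (B - A) < 2 * \<delta>"
    using A B dist_triangle2[of B A L] by (simp add: dist_norm)
  have AG: "A \<in> G" "B \<in> G" and AC: "A \<in> carrier SL2H" "B \<in> carrier SL2H"
    using A(1) B(1) subgroup.mem_carrier[OF G] by auto
  define J where "J = inv\<^bsub>SL2H\<^esub> A"
  have J: "norm (J $ i $ j) \<le> R" for i j
  proof -
    obtain a b c d where abcd: "A = mat2 a b c d"
      by (metis mat2_eta)
    then have D: "qdet_sq a b c d = 1"
      using AC by (simp add: mat2_in_SL2H)
    have "norm a \<le> R" "norm b \<le> R" "norm c \<le> R" "norm d \<le> R"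
      using A(1) unfolding abcd by (auto simp: forall_2)
    then have "\<forall>i j. norm (J $ i $ j) \<le> R"
      unfolding J_def abcd inv_SL2H[OF D] by (simp add: forall_2 norm_adj_entry[OF D])
    then show ?thesis by blast
  qed
  have JA: "J ** A = mat 1"
    using SL.l_inv[OF AC(1)] by (simp add: J_def SL2H_def)
  have entry: "norm ((J ** (B - A)) $ i $ j) \<le> 4 * R * \<delta>" for i j
  proof -
    have "norm (J $ i $ k * (B - A) $ k $ j) \<le> R * (2 * \<delta>)" for k
      unfolding norm_mult
      using J[of i k] norm_entry_le[of "B - A" k j] AB R by (intro mult_mono) auto
    from this[of 1] this[of 2] show ?thesis
      unfolding matrix_matrix_mult_def
      by (simp add: sum_2) (rule order_trans[OF norm_triangle_ineq], simp)
  qed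
  have "norm (J ** (B - A)) \<le> 4 * (4 * R * \<delta>)"
    by (rule norm_mat2_le) (rule entry)
  also have "\<dots> < e"
  proof -
    have "e = 16 * (R + 1) * \<delta>"
      using R by (simp add: \<delta>_def)
    then show ?thesis
      using \<delta> by (simp add: algebra_simps)
  qed
  also have "J ** (B - A) = J ** B - mat 1"
    unfolding JA[symmetric] by (simp add: vec_eq_iff matrix_matrix_mult_def right_diff_distrib sum_subtractf)
  finally have "dist (mat 1) (J ** B) < e"
    by (simp add: dist_norm norm_minus_commute)
  moreover have "J ** B \<in> G"
    using subgroup.m_closed[OF G subgroup.m_inv_closed[OF G AG(1)] AG(2)] by (simp add: J_def mult_SL2H)
  ultimately have "J ** B = mat 1"
    using e by blast
  then have "inv\<^bsub>SL2H\<^esub> A \<otimes>\<^bsub>SL2H\<^esub> B = inv\<^bsub>SL2H\<^esub> A \<otimes>\<^bsub>SL2H\<^esub> A"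
    using JA by (simp add: J_def mult_SL2H)
  then show False
    using \<open>A \<noteq> B\<close> AC by (metis SL.inv_closed SL.Units_eq SL.Units_l_cancel)
qed

section \<open>Conjugation by powers of diagonal elements\<close>

lemma finite_geometric_zero:
  assumes "finite F" "0 < r" "r < (1::real)" "\<And>k::nat. \<exists>A\<in>F. f A = y * r ^ k"
  shows "y = 0"
proof (rule ccontr)
  assume y: "y \<noteq> 0"
  have "inj (\<lambda>k::nat. y * r ^ k)"
  proof (rule injI)
    fix i j :: nat
    assume "y * r ^ i = y * r ^ j"
    then show "i = j"
      using y assms(2,3) by (metis mult_left_cancel less_irrefl linorder_neqE_nat power_strict_decreasing)
  qed
  then have "infinite (range (\<lambda>k::nat. y * r ^ k))"
    using finite_imageD by blast
  moreover have "range (\<lambda>k::nat. y * r ^ k) \<subseteq> f ` F"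
    using assms(4) by (metis imageI image_subsetI)
  ultimately show False
    using assms(1) finite_subset by blast
qed

lemma conj_diag_pow:
  assumes G: "subgroup G SL2H" and P: "mat2 p 0 0 s \<in> G" and A: "mat2 a b c d \<in> G"
  shows "\<exists>a' b' c' d'. mat2 a' b' c' d' \<in> G \<and> norm a' = norm a \<and> norm d' = norm d
    \<and> norm b' = norm b * ((norm p)\<^sup>2) ^ k \<and> norm c' = norm c * ((norm s)\<^sup>2) ^ k"
proof (induction k)
  case 0
  then show ?case using A by auto
next
  case (Suc k)
  then obtain a' b' c' d' where "mat2 a' b' c' d' \<in> G" "norm a' = norm a" "norm d' = norm d"
    "norm b' = norm b * ((norm p)\<^sup>2) ^ k" "norm c' = norm c * ((norm s)\<^sup>2) ^ k"
    by blast
  then show ?case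
    using conj_diag[OF G P, of a' b' c' d'] by (simp add: ac_simps)
qed

lemma diag_inv_in:
  assumes G: "subgroup G SL2H" and P: "mat2 p 0 0 s \<in> G"
  shows "\<exists>q t. mat2 q 0 0 t \<in> G \<and> norm q = norm s \<and> norm t = norm p"
proof -
  have D: "qdet_sq p 0 0 s = 1"
    using P subgroup.mem_carrier[OF G] mat2_in_SL2H by blast
  have "mat2 (adj_entry p 0 0 s) 0 0 (adj_entry s 0 0 p) \<in> G"
    using subgroup.m_inv_closed[OF G P] unfolding inv_SL2H[OF D] by (simp add: adj_entry_def)
  then show ?thesis
    using norm_adj_entry(1,4)[OF D] by blast
qed

lemma prod_eq_1_less:
  assumes "x * y = (1::real)" "y < x" "0 \<le> y"
  shows "1 < x" "0 < y" "y < 1"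
proof -
  show y: "0 < y" using assms by (cases "y = 0") auto
  show "1 < x"
  proof (rule ccontr)
    assume "\<not> 1 < x"
    then have "x * y \<le> 1 * y" using y by (intro mult_right_mono) auto
    then show False using assms \<open>\<not> 1 < x\<close> by linarith
  qed
  show "y < 1"
  proof (rule ccontr)
    assume "\<not> y < 1"
    then have "x * 1 \<le> x * y" using assms by (intro mult_left_mono) auto
    then show False using assms \<open>\<not> y < 1\<close> by linarith
  qed
qed

text \<open>If one off-diagonal entry is 0, powers of a suitable diagonal element shrink the other
  geometrically and keep the diagonal norms. The conjugates lie in a finite set, so the other entry
  is 0 too.\<close>

lemma discrete_triangular_diagonal:
  assumes G: "subgroup G SL2H" and disc: "discrete G" and T: "mat2 l 0 0 m \<in> G"
    and lm: "norm l \<noteq> norm m" and A: "mat2 a b c d \<in> G"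
  shows "b = 0 \<longleftrightarrow> c = 0"
proof -
  define R where "R = norm a + norm b + norm c + norm d"
  define F where "F = {A \<in> G. \<forall>i j. norm (A $ i $ j) \<le> R}"
  have F: "finite F"
    unfolding F_def by (rule discrete_subgroup_bounded_finite[OF G disc])
  obtain q t where Q: "mat2 q 0 0 t \<in> G" "norm q = norm m" "norm t = norm l"
    using diag_inv_in[OF G T] by blast
  \<comment> \<open>Either \<open>T\<close> or its inverse, according to which of
    \<open>norm l\<close>, \<open>norm m\<close> is larger; the next pair is chosen the opposite
    way.\<close>
  obtain p s where P: "mat2 p 0 0 s \<in> G" "norm s < norm p"
    using lm T Q by (metis linorder_neqE_linordered_idom)
  obtain p' s' where P': "mat2 p' 0 0 s' \<in> G" "norm p' < norm s'"
    using lm T Q by (metis linorder_neqE_linordered_idom)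
  have s: "0 < norm s" "norm s < 1"
    using prod_eq_1_less[of "norm p" "norm s"] P diag_norm_prod[OF G P(1)] by auto
  have p': "0 < norm p'" "norm p' < 1"
    using prod_eq_1_less[of "norm s'" "norm p'"] P' diag_norm_prod[OF G P'(1)] by (auto simp: mult.commute)
  have le: "z * r ^ k \<le> z" if "z \<ge> 0" "0 < r" "r < 1" for z r :: real and k
    using that by (simp add: mult_left_le power_le_one)
  show ?thesis
  proof
    assume b: "b = 0"
    have "\<exists>A\<in>F. norm (A $ 2 $ 1) = norm c * ((norm s)\<^sup>2) ^ k" for k
    proof -
      obtain a' b' c' d' where *: "mat2 a' b' c' d' \<in> G" "norm a' = norm a" "norm d' = norm d"
        "norm b' = 0" "norm c' = norm c * ((norm s)\<^sup>2) ^ k"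
        using conj_diag_pow[OF G P(1) A, of k] b by auto
      have "norm c' \<le> norm c"
        unfolding * using s by (intro le) (auto simp: power_less_one_iff)
      then have "norm a' \<le> R" "norm b' \<le> R" "norm c' \<le> R" "norm d' \<le> R"
        unfolding R_def *(2-4) using norm_ge_zero[of a] norm_ge_zero[of b] norm_ge_zero[of c] norm_ge_zero[of d]
        by linarith+
      then have "mat2 a' b' c' d' \<in> F"
        using *(1) by (simp add: F_def forall_2)
      then show ?thesis using * by (metis mat2_nth(3))
    qed
    then have "norm c = 0"
      using s by (intro finite_geometric_zero[OF F, where r = "(norm s)\<^sup>2" and f = "\<lambda>A. norm (A $ 2 $ 1)"]) (auto simp: power_less_one_iff)
    then show "c = 0" by simp
  next
    assume c: "c = 0"
    have "\<exists>A\<in>F. norm (A $ 1 $ 2) = norm b * ((norm p')\<^sup>2) ^ k" for k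
    proof -
      obtain a' b' c' d' where *: "mat2 a' b' c' d' \<in> G" "norm a' = norm a" "norm d' = norm d"
        "norm c' = 0" "norm b' = norm b * ((norm p')\<^sup>2) ^ k"
        using conj_diag_pow[OF G P'(1) A, of k] c by auto
      have "norm b' \<le> norm b"
        unfolding * using p' by (intro le) (auto simp: power_less_one_iff)
      then have "norm a' \<le> R" "norm b' \<le> R" "norm c' \<le> R" "norm d' \<le> R"
        unfolding R_def *(2-4) using norm_ge_zero[of a] norm_ge_zero[of b] norm_ge_zero[of c] norm_ge_zero[of d]
        by linarith+
      then have "mat2 a' b' c' d' \<in> F"
        using *(1) by (simp add: F_def forall_2)
      then show ?thesis using * by (metis mat2_nth(2))
    qed
    then have "norm b = 0"
      using p' by (intro finite_geometric_zero[OF F, where r = "(norm p')\<^sup>2" and f = "\<lambda>A. norm (A $ 1 $ 2)"]) (auto simp: power_less_one_iff)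
    then show "b = 0" by simp
  qed
qed

text \<open>Conjugation multiplies |b| by integer powers of |p|^2 > 1, and the interval from 1 to
  |p|^2 meets every orbit of this scaling.\<close>

lemma discrete_normalise:
  assumes G: "subgroup G SL2H" and P: "mat2 p 0 0 s \<in> G" and sp: "norm s < norm p"
    and A: "mat2 a b c d \<in> G" and b: "b \<noteq> 0"
  shows "\<exists>a' b' c' d'. mat2 a' b' c' d' \<in> G \<and> norm a' = norm a \<and> norm d' = norm d
    \<and> norm b' * norm c' = norm b * norm c \<and> 1 \<le> norm b' \<and> norm b' \<le> (norm p)\<^sup>2"
proof -
  define \<rho> where "\<rho> = (norm p)\<^sup>2"
  define y where "y = norm b"
  have ps: "norm p * norm s = 1"
    by (rule diag_norm_prod[OF G P])
  then have \<rho>: "\<rho> > 1"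
    using prod_eq_1_less(1)[OF ps sp] one_less_power[of "norm p" 2] by (simp add: \<rho>_def)
  have "\<rho> * (norm s)\<^sup>2 = 1"
    using ps by (simp add: \<rho>_def power_mult_distrib [symmetric])
  then have s: "(norm s)\<^sup>2 = inverse \<rho>"
    by (rule inverse_unique[symmetric])
  have y: "y > 0"
    using b by (simp add: y_def)
  define k where "k = \<lfloor>log \<rho> y\<rfloor>"
  have yk: "\<rho> powi k \<le> y" "y \<le> \<rho> * \<rho> powi k"
  proof -
    have k1: "real_of_int k \<le> log \<rho> y" and k2: "log \<rho> y \<le> 1 + real_of_int k"
      unfolding k_def by linarith+
    have "y = \<rho> powr (log \<rho> y)"
      using y \<rho> by simp
    moreover have "\<rho> powr (real_of_int k) \<le> \<rho> powr (log \<rho> y)"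
      using k1 \<rho> by (intro powr_mono) auto
    moreover have "\<rho> powr (log \<rho> y) \<le> \<rho> powr (1 + real_of_int k)"
      using k2 \<rho> by (intro powr_mono) auto
    moreover have "\<rho> powr (1 + real_of_int k) = \<rho> * \<rho> powr (real_of_int k)"
      using \<rho> by (simp add: powr_add)
    moreover have "\<rho> powr (real_of_int k) = \<rho> powi k"
      using \<rho> by (simp add: powr_real_of_int')
    ultimately show "\<rho> powi k \<le> y" "y \<le> \<rho> * \<rho> powi k"
      by simp_all
  qed
  have ex: "\<exists>a' b' c' d'. mat2 a' b' c' d' \<in> G \<and> norm a' = norm a \<and> norm d' = norm d
      \<and> norm b' = y / \<rho> powi k \<and> norm c' = norm c * \<rho> powi k"
  proof (cases "k \<ge> 0")
    case True
    \<comment> \<open>Dividing |b| by a nonnegative power takes conjugation by the inverse of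
      diag(p, s).\<close>
    obtain q t where Q: "mat2 q 0 0 t \<in> G" "norm q = norm s" "norm t = norm p"
      using diag_inv_in[OF G P] by blast
    have "y * ((norm q)\<^sup>2) ^ nat k = y / \<rho> powi k" "norm c * ((norm t)\<^sup>2) ^ nat k = norm c * \<rho> powi k"
      using True by (simp_all add: Q s \<rho>_def[symmetric] power_int_def power_inverse divide_inverse)
    then show ?thesis
      using conj_diag_pow[OF G Q(1) A, of "nat k"] unfolding y_def by metis
  next
    case False
    have "y * ((norm p)\<^sup>2) ^ nat (- k) = y / \<rho> powi k" "norm c * ((norm s)\<^sup>2) ^ nat (- k) = norm c * \<rho> powi k"
      using False by (simp_all add: s \<rho>_def[symmetric] power_int_def power_inverse divide_inverse)
    then show ?thesis
      using conj_diag_pow[OF G P A, of "nat (- k)"] unfolding y_def by metis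
  qed
  have pk: "\<rho> powi k > 0"
    using \<rho> by simp
  have "1 \<le> y / \<rho> powi k" "y / \<rho> powi k \<le> \<rho>" "(y / \<rho> powi k) * (norm c * \<rho> powi k) = norm b * norm c"
    using yk pk \<rho> by (simp_all add: field_simps y_def)
  with ex show ?thesis
    unfolding \<rho>_def[symmetric] by metis
qed

lemma conj_diag_entry_norm_ge:
  assumes "qdet_sq a b c d = 1"
  shows "\<bar>norm a * norm d * norm l - norm b * norm c * norm m\<bar> \<le> norm (conj_diag_entry a b c d l m)"
  unfolding conj_diag_entry_def
  using norm_triangle_ineq3[of "a * l * adj_entry a b c d" "- (b * m * adj_entry b a d c)"]
  by (simp add: norm_mult norm_adj_entry[OF assms] ac_simps)

section \<open>The case of a loxodromic diagonal element\<close>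

text \<open>The last hypothesis is an inequality because the descent preserves only that. The
  condition on \<open>a\<close> and \<open>d\<close> keeps the off-diagonal entries nonzero.\<close>

lemma no_discrete_loxodromic:
  assumes G: "subgroup G SL2H" and disc: "discrete G" and T: "mat2 l 0 0 m \<in> G"
    and lm: "norm l \<noteq> norm m"
    and A: "mat2 a b c d \<in> G" and bc: "b \<noteq> 0" "c \<noteq> 0" and ad: "a \<noteq> 0 \<or> d \<noteq> 0"
    and jb: "jorgensen_const l m * (1 + norm b * norm c) \<le> 1"
  shows False
proof -
  define \<beta> where "\<beta> = jorgensen_const l m"
  have lm1: "norm l * norm m = 1"
    by (rule diag_norm_prod[OF G T])
  have \<beta>: "\<beta> > 0"
  proof -
    have "qRe l \<noteq> qRe m \<or> norm (qIm l) + norm (qIm m) \<noteq> 0"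
    proof (rule ccontr)
      assume *: "\<not> ?thesis"
      then have "norm (qIm l) = 0" "norm (qIm m) = 0"
        using norm_ge_zero[of "qIm l"] norm_ge_zero[of "qIm m"] by linarith+
      then have "(norm l)\<^sup>2 = (qRe l)\<^sup>2" "(norm m)\<^sup>2 = (qRe m)\<^sup>2"
        using norm_qIm_power2[of l] norm_qIm_power2[of m] by simp_all
      with * have "(norm l)\<^sup>2 = (norm m)\<^sup>2" by simp
      with lm show False by simp
    qed
    then show ?thesis
      unfolding \<beta>_def jorgensen_const_def
      by (smt (verit) zero_le_power2 zero_eq_power2)
  qed
  obtain q t where Q: "mat2 q 0 0 t \<in> G" "norm q = norm m" "norm t = norm l"
    using diag_inv_in[OF G T] by blast
  obtain p s where P: "mat2 p 0 0 s \<in> G" "norm s < norm p"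
    using lm T Q by (metis linorder_neqE_linordered_idom)
  \<comment> \<open>The class that conjugating \<open>T\<close> maps to itself; \<open>R\<close>
    bounds all diagonal entries so obtained, as |ad| and |bc| are at most
    \<open>1 / \<beta>\<close>.\<close>
  define good where "good a b c d \<longleftrightarrow> mat2 a b c d \<in> G \<and> b \<noteq> 0 \<and> c \<noteq> 0 \<and> (a \<noteq> 0 \<or> d \<noteq> 0)
    \<and> \<beta> * (1 + norm b * norm c) \<le> 1" for a b c d
  define R where "R = (norm l + norm m) / \<beta>"
  define F where "F = {(a, b, c, d). good a b c d \<and> norm a \<le> R \<and> norm d \<le> R
    \<and> 1 \<le> norm b \<and> norm b \<le> (norm p)\<^sup>2}"
  have prod_le: "norm b * norm c \<le> 1 / \<beta>" "1 + norm b * norm c \<le> 1 / \<beta>" if "good a b c d" for a b c d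
  proof -
    show "1 + norm b * norm c \<le> 1 / \<beta>"
      using that \<beta> by (simp add: good_def field_simps)
    then show "norm b * norm c \<le> 1 / \<beta>" by linarith
  qed
  have D: "qdet_sq a b c d = 1" if "good a b c d" for a b c d
    using that subgroup.mem_carrier[OF G] mat2_in_SL2H unfolding good_def by blast
  have step: "good a' b' c' d' \<and> norm a' \<le> R \<and> norm d' \<le> R \<and> norm b' * norm c' \<le> norm b * norm c
      \<and> norm (conj_off_entry a' b' c' d' l m) * norm (conj_off_entry d' c' b' a' m l) < norm b * norm c"
    if g: "good a b c d" and a': "a' = conj_diag_entry a b c d l m" and b': "b' = conj_off_entry a b c d l m"
      and c': "c' = conj_off_entry d c b a m l" and d': "d' = conj_diag_entry d c b a m l" for a b c d a' b' c' d'
  proof -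
    note D1 = D[OF g]
    have D2: "qdet_sq d c b a = 1"
      using D1 by (simp add: qdet_sq_swap qdet_sq_swap_cols)
    have nz: "b \<noteq> 0" "c \<noteq> 0" "a \<noteq> 0 \<or> d \<noteq> 0" and AG: "mat2 a b c d \<in> G"
      and jb1: "jorgensen_const l m * (1 + norm b * norm c) \<le> 1"
      using g by (auto simp: good_def \<beta>_def)
    have mem: "mat2 a' b' c' d' \<in> G"
      unfolding a' b' c' d' conj_mat2[OF D1, symmetric]
      using G T AG by (simp add: subgroup.m_closed subgroup.m_inv_closed)
    then have D': "qdet_sq a' b' c' d' = 1"
      using subgroup.mem_carrier[OF G] mat2_in_SL2H by blast
    note desc = conj_off_entry_prod_descent[OF D1 nz(1,2) jb1 lm1 lm a' b' c' d' D']
    \<comment> \<open>If one of \<open>b'\<close>, \<open>c'\<close> vanished, so would the other,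
      and then \<open>a = d = 0\<close>.\<close>
    have "b' = 0 \<Longrightarrow> a = 0"
      using conj_off_entry_norm_ge[OF D1, of l m] nz(1) lm unfolding b'
      by (auto simp: mult_le_0_iff)
    moreover have "c' = 0 \<Longrightarrow> d = 0"
      using conj_off_entry_norm_ge[OF D2, of m l] nz(2) lm unfolding c'
      by (auto simp: mult_le_0_iff)
    moreover have "b' = 0 \<longleftrightarrow> c' = 0"
      by (rule discrete_triangular_diagonal[OF G disc T lm mem])
    ultimately have nz': "b' \<noteq> 0" "c' \<noteq> 0"
      using nz(3) by blast+
    define x where "x = norm b * norm c"
    define y where "y = norm a * norm d"
    have x: "x > 0"
      using nz by (simp add: x_def)
    have y: "y \<ge> 0" "y \<le> 1 + x"
      using norm_ad_le(1)[OF D1] by (simp_all add: x_def y_def)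
    \<comment> \<open>If both vanished, the two relations would give \<open>y = 0\<close> because
      \<open>norm l \<noteq> norm m\<close>, and then \<open>x = 0\<close>.\<close>
    have ad': "a' \<noteq> 0 \<or> d' \<noteq> 0"
    proof (rule ccontr)
      assume "\<not> ?thesis"
      then have *: "y * norm l = x * norm m" "y * norm m = x * norm l"
        using conj_diag_entry_norm_ge[OF D1, of l m] conj_diag_entry_norm_ge[OF D2, of m l]
        by (simp_all add: a' d' x_def y_def mult.commute)
      have "y * (norm l * norm l) = x * norm m * norm l"
        unfolding *(1)[symmetric] by simp
      also have "\<dots> = y * norm m * norm m"
        unfolding *(2) by simp
      finally have "y * (norm l * norm l) = y * (norm m * norm m)"
        by simp
      then have "y = 0"
        using lm by (metis mult_left_cancel norm_ge_zero power2_eq_square power2_eq_iff_nonneg)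
      with * x lm1 show False by auto
    qed
    have bound: "y * u + x * v \<le> (u + v) / \<beta>" if "u \<ge> 0" "v \<ge> 0" for u v
    proof -
      have "y \<le> 1 / \<beta>" "x \<le> 1 / \<beta>"
        using prod_le[OF g] y by (simp_all add: x_def)
      then have "y * u \<le> 1 / \<beta> * u" "x * v \<le> 1 / \<beta> * v"
        using that by (simp_all only: mult_right_mono)
      then show ?thesis
        by (simp add: add_divide_distrib)
    qed
    have "norm a' \<le> R"
      using conj_diag_entry_norm_le[OF D1, of l m] bound[of "norm l" "norm m"]
      by (simp add: a' x_def y_def R_def)
    moreover have "norm d' \<le> R"
      using conj_diag_entry_norm_le[OF D2, of m l] bound[of "norm m" "norm l"]
      by (simp add: d' x_def y_def R_def ac_simps)
    moreover have "\<beta> * (1 + norm b' * norm c') \<le> 1"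
      using mult_left_mono[of "1 + norm b' * norm c'" "1 + norm b * norm c" \<beta>] desc(1) \<beta> jb1
      unfolding \<beta>_def by linarith
    ultimately show ?thesis
      using desc mem nz' ad' by (simp add: good_def)
  qed
  have norml: "\<exists>z\<in>F. (case z of (a, b, c, d) \<Rightarrow> norm b * norm c) = norm b * norm c"
    if g: "good a b c d" and R: "norm a \<le> R" "norm d \<le> R" for a b c d
  proof -
    obtain a' b' c' d' where *: "mat2 a' b' c' d' \<in> G" "norm a' = norm a" "norm d' = norm d"
      "norm b' * norm c' = norm b * norm c" "1 \<le> norm b'" "norm b' \<le> (norm p)\<^sup>2"
      using discrete_normalise[OF G P, of a b c d] g unfolding good_def by blast
    have nz: "norm b \<noteq> 0" "norm c \<noteq> 0" "norm a \<noteq> 0 \<or> norm d \<noteq> 0"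
      using g by (auto simp: good_def)
    then have "norm b' * norm c' \<noteq> 0"
      unfolding *(4) by simp
    then have "b' \<noteq> 0" "c' \<noteq> 0" by auto
    moreover have "a' \<noteq> 0 \<or> d' \<noteq> 0"
      using nz(3) unfolding *(2,3)[symmetric] by simp
    ultimately have "(a', b', c', d') \<in> F"
      using * R g by (simp add: F_def good_def)
    then show ?thesis
      using *(4) by (intro bexI[of _ "(a', b', c', d')"]) auto
  qed
  \<comment> \<open>Two conjugations decrease the product; normalisation then returns to
    \<open>F\<close> without changing it.\<close>
  have descent: "\<exists>z'\<in>F. (case z' of (a, b, c, d) \<Rightarrow> norm b * norm c) < norm b * norm c"
    if g: "good a b c d" for a b c d
  proof -
    define a' b' c' d' where abcd': "a' = conj_diag_entry a b c d l m" "b' = conj_off_entry a b c d l m"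
      "c' = conj_off_entry d c b a m l" "d' = conj_diag_entry d c b a m l"
    note s1 = step[OF g abcd']
    then have g': "good a' b' c' d'" by blast
    define a'' b'' c'' d'' where abcd'': "a'' = conj_diag_entry a' b' c' d' l m" "b'' = conj_off_entry a' b' c' d' l m"
      "c'' = conj_off_entry d' c' b' a' m l" "d'' = conj_diag_entry d' c' b' a' m l"
    note s2 = step[OF g' abcd'']
    have "norm b'' * norm c'' < norm b * norm c"
      using s1 by (simp add: abcd'')
    moreover have "\<exists>z\<in>F. (case z of (a, b, c, d) \<Rightarrow> norm b * norm c) = norm b'' * norm c''"
      using norml[of a'' b'' c'' d''] s2 by blast
    ultimately show ?thesis by metis
  qed
  have "finite F"
  proof -
    define R' where "R' = R + (norm p)\<^sup>2 + 1 / \<beta>"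
    have "(\<lambda>(a, b, c, d). mat2 a b c d) ` F \<subseteq> {A \<in> G. \<forall>i j. norm (A $ i $ j) \<le> R'}"
    proof (intro image_subsetI, clarify, intro CollectI conjI)
      fix a b c d assume F: "(a, b, c, d) \<in> F"
      then have g: "good a b c d" by (simp add: F_def)
      then show "mat2 a b c d \<in> G" by (simp add: good_def)
      have R: "R \<ge> 0"
        using \<beta> by (simp add: R_def)
      \<comment> \<open>The lower bound on |b| turns the bound for the product into one for
        |c|.\<close>
      have "1 * norm c \<le> norm b * norm c"
        using F by (intro mult_right_mono) (auto simp: F_def)
      then have "norm c \<le> 1 / \<beta>"
        using prod_le(1)[OF g] by linarith
      moreover have "norm a \<le> R" "norm d \<le> R" "norm b \<le> (norm p)\<^sup>2"
        using F by (auto simp: F_def)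
      moreover have "1 / \<beta> \<ge> 0" "(norm p)\<^sup>2 \<ge> 0"
        using \<beta> by auto
      ultimately have "norm a \<le> R'" "norm b \<le> R'" "norm c \<le> R'" "norm d \<le> R'"
        using R unfolding R'_def by linarith+
      then show "\<forall>i j. norm (mat2 a b c d $ i $ j) \<le> R'"
        by (simp add: forall_2)
    qed
    then have "finite ((\<lambda>(a, b, c, d). mat2 a b c d) ` F)"
      using discrete_subgroup_bounded_finite[OF G disc] finite_subset by blast
    moreover have "inj_on (\<lambda>(a, b, c, d). mat2 a b c d) F"
    proof (rule inj_onI)
      fix z z' :: "quat \<times> quat \<times> quat \<times> quat"
      assume "(case z of (a, b, c, d) \<Rightarrow> mat2 a b c d) = (case z' of (a, b, c, d) \<Rightarrow> mat2 a b c d)"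
      then show "z = z'"
        by (cases z; cases z') (simp, metis mat2_nth)
    qed
    ultimately show ?thesis
      by (rule finite_imageD)
  qed
  have "good a b c d"
    using A bc ad jb by (simp add: good_def \<beta>_def)
  then have "F \<noteq> {}"
    using descent by blast
  define f where "f = (\<lambda>(a :: quat, b :: quat, c :: quat, d :: quat). norm b * norm c)"
  obtain z where z: "z \<in> F" "\<And>z'. z' \<in> F \<Longrightarrow> f z \<le> f z'"
    using ex_min_if_finite[of "f ` F"] \<open>finite F\<close> \<open>F \<noteq> {}\<close> by (force simp: not_less)
  obtain a0 b0 c0 d0 where zz: "z = (a0, b0, c0, d0)"
    by (metis prod.collapse)
  then have "good a0 b0 c0 d0"
    using z(1) by (simp add: F_def)
  then obtain z' where "z' \<in> F" "f z' < norm b0 * norm c0"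
    unfolding f_def using descent by blast
  moreover have "f z = norm b0 * norm c0"
    by (simp add: f_def zz)
  ultimately show False
    using z(2)[of z'] by simp
qed

section \<open>Elementary groups\<close>

lemma generate_subset:
  assumes "\<And>A. A \<in> H \<Longrightarrow> A \<in> X" "\<And>A. A \<in> H \<Longrightarrow> inv\<^bsub>SL2H\<^esub> A \<in> X"
    and "mat2 1 0 0 1 \<in> X" "\<And>A B. A \<in> X \<Longrightarrow> B \<in> X \<Longrightarrow> A ** B \<in> X"
  shows "generate SL2H H \<subseteq> X"
proof
  fix A assume "A \<in> generate SL2H H"
  then show "A \<in> X"
    by induction (use assms in \<open>auto simp: one_SL2H mult_SL2H\<close>)
qed

lemma elementaryI_moebius:
  assumes "\<And>A. A \<in> G \<Longrightarrow> moebius A w \<in> {Fin 0, Infty}"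
  shows "elementary G"
proof -
  have "(\<lambda>A. moebius A w) ` G \<subseteq> {Fin 0, Infty}"
    using assms by blast
  then have "finite ((\<lambda>A. moebius A w) ` G)"
    using finite_subset by blast
  then show ?thesis
    unfolding elementary_def by blast
qed

text \<open>The orbit of 0, or of infinity in the last two cases, stays in {0, infinity}, because
  the zero pattern of the generators persists in the group.\<close>

lemma elementary_cases:
  assumes D: "qdet_sq a b c d = 1" and T: "qdet_sq l 0 0 m = 1"
    and z: "b = 0 \<or> c = 0 \<or> a = 0 \<and> d = 0"
  shows "elementary (generate SL2H {mat2 a b c d, mat2 l 0 0 m})" (is "elementary ?G")
proof -
  consider "b = 0" | "c = 0" | "a = 0" "d = 0"
    using z by blast
  then show ?thesis
  proof cases
    case 1
    have "?G \<subseteq> {A. A $ 1 $ 2 = 0}"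
      using 1 by (intro generate_subset)
        (auto simp: inv_SL2H[OF D[unfolded 1]] inv_SL2H[OF T] adj_entry_def matrix_matrix_mult_def sum_2)
    then show ?thesis
      by (intro elementaryI_moebius[where w = "Fin 0"]) (auto simp: Let_def)
  next
    case 2
    have "?G \<subseteq> {A. A $ 2 $ 1 = 0}"
      using 2 by (intro generate_subset)
        (auto simp: inv_SL2H[OF D[unfolded 2]] inv_SL2H[OF T] adj_entry_def matrix_matrix_mult_def sum_2)
    then show ?thesis
      by (intro elementaryI_moebius[where w = Infty]) auto
  next
    case 3
    have "?G \<subseteq> {A. A $ 1 $ 2 = 0 \<and> A $ 2 $ 1 = 0 \<or> A $ 1 $ 1 = 0 \<and> A $ 2 $ 2 = 0}"
      using 3 by (intro generate_subset)
        (auto simp: inv_SL2H[OF D[unfolded 3]] inv_SL2H[OF T] adj_entry_def matrix_matrix_mult_def sum_2)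
    then show ?thesis
      by (intro elementaryI_moebius[where w = Infty]) auto
  qed
qed

section \<open>The elliptic case\<close>

text \<open>
  Powers of \<open>l\<close> are computed in the copy of the complex numbers spanned by 1 and the imaginary part of \<open>l\<close>.
\<close>

lemma quat_power_complex:
  "\<exists>s. l ^ n = of_real (Re (Complex (qRe l) (norm (qIm l)) ^ n)) + s *\<^sub>R qIm l
     \<and> Im (Complex (qRe l) (norm (qIm l)) ^ n) = s * norm (qIm l)"
proof (induction n)
  case 0
  then show ?case by (intro exI[of _ 0]) simp
next
  case (Suc n)
  define L where "L = Complex (qRe l) (norm (qIm l))"
  obtain s where s: "l ^ n = of_real (Re (L ^ n)) + s *\<^sub>R qIm l" "Im (L ^ n) = s * norm (qIm l)"
    using Suc by (auto simp: L_def)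
  define r where "r = Re (L ^ n)"
  have n2: "norm (qIm l) * norm (qIm l) = (qI l)\<^sup>2 + (qJ l)\<^sup>2 + (qK l)\<^sup>2"
    using norm_quat_power2[of "qIm l"] by (simp add: qIm_def power2_eq_square)
  have re: "Re (L ^ Suc n) = qRe l * r - s * ((qI l)\<^sup>2 + (qJ l)\<^sup>2 + (qK l)\<^sup>2)"
    using s(2) by (simp add: n2[symmetric] r_def) (simp add: L_def)
  have im: "Im (L ^ Suc n) = (r + s * qRe l) * norm (qIm l)"
    using s(2) by (simp add: r_def) (simp add: L_def algebra_simps)
  have "l ^ Suc n = of_real (Re (L ^ Suc n)) + (r + s * qRe l) *\<^sub>R qIm l"
    unfolding re unfolding power_Suc s(1) r_def[symmetric]
    by (simp add: quat_eq_iff quat_mult_simps qIm_def of_real_def power2_eq_square algebra_simps)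
  with im show ?case
    unfolding L_def by blast
qed

lemma quat_power_real:
  assumes "qIm (l ^ n) = 0"
  shows "Complex (qRe l) (norm (qIm l)) ^ n = of_real (qRe (l ^ n))"
proof -
  obtain s where s: "l ^ n = of_real (Re (Complex (qRe l) (norm (qIm l)) ^ n)) + s *\<^sub>R qIm l"
    "Im (Complex (qRe l) (norm (qIm l)) ^ n) = s * norm (qIm l)"
    using quat_power_complex by blast
  have "qRe (l ^ n) = Re (Complex (qRe l) (norm (qIm l)) ^ n)"
    unfolding s(1) by (simp add: of_real_def qIm_def)
  moreover have "s *\<^sub>R qIm l = qIm (l ^ n)"
    unfolding s(1) by (simp add: quat_eq_iff of_real_def qIm_def)
  then have "s * norm (qIm l) = 0"
    using assms by simp
  ultimately show ?thesis
    using s(2) by (simp add: complex_eq_iff)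
qed

text \<open>Distance below 1 means an argument below pi/3 in absolute value; multiplied by at most 6
  it stays below 2 pi, so it can be a multiple of 2 pi only if it is 0.\<close>

lemma root_of_unity_close:
  fixes w :: complex
  assumes "w ^ n = 1" "0 < n" "n < 7" "norm (w - 1) < 1"
  shows "w = 1"
proof -
  have nw: "norm w = 1"
    using assms(1,2) by (metis norm_one norm_power norm_ge_zero power_eq_1_iff less_numeral_extra(3))
  define \<theta> where "\<theta> = Arg w"
  have w: "w = cis \<theta>"
    using nw by (metis \<theta>_def cis_Arg norm_zero sgn_div_norm zero_neq_one div_by_1 inverse_1 scaleR_one)
  have \<theta>: "- pi < \<theta>" "\<theta> \<le> pi"
    using Arg_bounded[of w] by (auto simp: \<theta>_def)
  have "(norm (w - 1))\<^sup>2 < 1"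
    using assms(4) by (simp add: power_less_one_iff)
  moreover have "(norm (w - 1))\<^sup>2 = 2 - 2 * cos \<theta>"
    using sin_cos_squared_add[of \<theta>]
    unfolding cmod_power2 w by (simp add: power2_eq_square algebra_simps)
  ultimately have "cos (pi / 3) < cos \<bar>\<theta>\<bar>"
    by (simp add: cos_60)
  then have t3: "\<bar>\<theta>\<bar> < pi / 3"
    using \<theta> by (subst (asm) cos_mono_less_eq) auto
  have "cis (real n * \<theta>) = 1"
    using assms(1) unfolding w Complex.DeMoivre .
  then have "cos (real n * \<theta>) = 1"
    by (metis cis.simps(1) one_complex.simps(1))
  then obtain k :: int where k: "real n * \<theta> = real_of_int k * 2 * pi"
    using cos_one_2pi_int by blast
  have "\<bar>real n * \<theta>\<bar> < 2 * pi"
  proof -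
    have "\<bar>real n * \<theta>\<bar> \<le> 6 * \<bar>\<theta>\<bar>"
      unfolding abs_mult using assms(3) by (intro mult_right_mono) auto
    with t3 show ?thesis by simp
  qed
  then have "\<bar>real_of_int k\<bar> < 1"
    unfolding k by (simp add: abs_mult)
  then have "k = 0" by linarith
  with k assms(2) have "\<theta> = 0" by simp
  then show ?thesis by (simp add: w)
qed

text \<open>The hypothesis on all \<open>z\<close> makes \<open>l ^ N = m ^ N\<close> central, hence
  real. So \<open>L / cnj M\<close> is an N-th root of unity, and its squared distance to 1 is
  beta.\<close>

lemma diag_order_ge_7:
  assumes n: "norm l = 1" "norm m = 1" and jb: "0 < jorgensen_const l m" "jorgensen_const l m < 1"
    and N: "0 < N" and fixed: "\<And>z. l ^ N * z * qcnj m ^ N = z"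
  shows "7 \<le> N"
proof (rule ccontr)
  assume "\<not> 7 \<le> N"
  define L where "L = Complex (qRe l) (norm (qIm l))"
  define M where "M = Complex (qRe m) (norm (qIm m))"
  have qcp: "qcnj m ^ k * m ^ k = 1" for k
  proof (induction k)
    case (Suc k)
    have "qcnj m ^ Suc k * m ^ Suc k = qcnj m ^ k * (qcnj m * m) * m ^ k"
      by (simp add: power_Suc2 mult.assoc del: power_Suc) (simp add: power_commutes)
    with Suc show ?case by (simp add: mult_qcnj n)
  qed simp
  have comm: "l ^ N * z = z * m ^ N" for z
    using fixed[of z] qcp[of N] by (metis mult.assoc mult_1_right)
  have eq: "l ^ N = m ^ N"
    using comm[of 1] by simp
  \<comment> \<open>Commuting with the units i and j leaves no imaginary part.\<close>
  have I: "qIm (l ^ N) = 0"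
    using comm[of "Quat 0 1 0 0"] comm[of "Quat 0 0 1 0"] unfolding eq
    by (simp add: quat_eq_iff quat_mult_simps qIm_def)
  have LN: "L ^ N = of_real (qRe (l ^ N))"
    unfolding L_def by (rule quat_power_real[OF I])
  have "M ^ N = of_real (qRe (m ^ N))"
    unfolding M_def using I unfolding eq by (rule quat_power_real)
  \<comment> \<open>A real \<open>M ^ N\<close> equals its own conjugate, so \<open>M\<close> may be
    replaced by the eigenvalue \<open>cnj M\<close> in the lower half plane.\<close>
  then have LM: "L ^ N = cnj M ^ N"
    unfolding LN eq by (metis complex_cnj_complex_of_real complex_cnj_power)
  have nM: "norm M = 1"
    using n norm_qIm_power2[of m] by (simp add: M_def complex_norm)
  then have M0: "cnj M \<noteq> 0" by auto
  have jbLM: "(norm (L - cnj M))\<^sup>2 = jorgensen_const l m"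
    by (simp add: cmod_power2 L_def M_def jorgensen_const_def)
  have "L / cnj M - 1 = (L - cnj M) / cnj M"
    using M0 by (simp add: diff_divide_distrib)
  then have "norm (L / cnj M - 1) = norm (L - cnj M)"
    using nM by (simp add: norm_divide)
  also have "\<dots> < 1"
    using jb(2) jbLM by (metis abs_norm_cancel abs_square_less_1)
  finally have close: "norm (L / cnj M - 1) < 1" .
  have "(L / cnj M) ^ N = 1"
    unfolding power_divide LM by (rule divide_self) (use M0 in simp)
  then have "L / cnj M = 1"
    by (rule root_of_unity_close) (use close N \<open>\<not> 7 \<le> N\<close> in simp_all)
  then have "L = cnj M"
    using M0 by simp
  then show False
    using jbLM jb(1) by simp
qed

section \<open>The order of a diagonal isometry\<close>

lemma poincare_ext_diag:
  "norm m = 1 \<Longrightarrow> poincare_ext (mat2 l 0 0 m) (z, t) = (l * z * qcnj m, t)"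
  by (simp add: poincare_ext_def Let_def)

lemma diag_power_mem:
  assumes "subgroup G SL2H" "mat2 l 0 0 m \<in> G"
  shows "mat2 (l ^ k) 0 0 (m ^ k) \<in> G"
proof (induction k)
  case 0
  then show ?case
    using subgroup.one_closed[OF assms(1)] by (simp add: one_SL2H)
next
  case (Suc k)
  then show ?case
    using subgroup.m_closed[OF assms(1) assms(2) Suc] by (simp add: mult_SL2H mat2_mult)
qed

text \<open>All powers have entries of norm at most 1, so they form a finite set and two of them
  coincide.\<close>

lemma discrete_diag_finite_order:
  assumes G: "subgroup G SL2H" and disc: "discrete G" and T: "mat2 l 0 0 m \<in> G"
    and n: "norm l = 1" "norm m = 1"
  shows "\<exists>k>0. l ^ k = 1 \<and> m ^ k = 1"
proof -
  let ?f = "\<lambda>k. mat2 (l ^ k) 0 0 (m ^ k)"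
  have "range ?f \<subseteq> {A \<in> G. \<forall>i j. norm (A $ i $ j) \<le> 1}"
    using diag_power_mem[OF G T] by (auto simp: forall_2 norm_power n)
  then have "finite (range ?f)"
    using discrete_subgroup_bounded_finite[OF G disc] finite_subset by blast
  then have "\<not> inj ?f"
    using finite_imageD infinite_UNIV_nat by blast
  then obtain i j where "i < j" "?f i = ?f j"
    unfolding inj_def by (metis linorder_neqE_nat)
  then have "l ^ i = l ^ j" "m ^ i = m ^ j"
    by (metis mat2_nth)+
  moreover have "z ^ (j - i) = 1" if "z ^ i = z ^ j" "norm z = 1" for z :: quat
  proof -
    have "z ^ i * z ^ (j - i) = z ^ i * 1"
      using that(1) power_add[of z i "j - i"] \<open>i < j\<close> by simp
    moreover have "z ^ i \<noteq> 0"
      using that(2) by auto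
    ultimately show ?thesis
      using mult_left_cancel by blast
  qed
  ultimately show ?thesis
    using n \<open>i < j\<close> by (intro exI[of _ "j - i"]) auto
qed

text \<open>For |m| = 1 the isometry of diag(l, m) is \<open>diag_map l (qcnj m)\<close>.
  Restriction to \<open>H5\<close> makes the map extensional, as \<open>Bij\<close> demands.\<close>

definition diag_map :: "quat \<Rightarrow> quat \<Rightarrow> quat \<times> real \<Rightarrow> quat \<times> real" where
  "diag_map p q = (\<lambda>(z, t)\<in>H5. (p * z * q, t))"

lemma diag_map_Bij:
  assumes "p \<noteq> 0" "q \<noteq> 0"
  shows "diag_map p q \<in> Bij H5"
proof -
  have "bij_betw (diag_map p q) H5 H5"
    using assms
    by (intro bij_betwI[where g = "diag_map (inverse p) (inverse q)"])
      (auto simp: diag_map_def H5_def mult.assoc, auto simp: mult.assoc [symmetric])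
  then show ?thesis
    by (simp add: Bij_def diag_map_def)
qed

lemma diag_map_pow:
  assumes "p \<noteq> 0" "q \<noteq> 0"
  shows "diag_map p q [^]\<^bsub>BijGroup H5\<^esub> n = diag_map (p ^ n) (q ^ n)"
proof (induction n)
  case 0
  show ?case
    by (simp add: BijGroup_def diag_map_def) (auto simp: restrict_def)
next
  case (Suc n)
  have "diag_map p q [^]\<^bsub>BijGroup H5\<^esub> Suc n = compose H5 (diag_map (p ^ n) (q ^ n)) (diag_map p q)"
    using Suc diag_map_Bij[of "p ^ n" "q ^ n"] diag_map_Bij[of p q] assms
    by (simp add: BijGroup_def)
  also have "\<dots> = diag_map (p ^ Suc n) (q ^ Suc n)"
  proof -
    have "p ^ Suc n * x = p ^ n * (p * x)" for x
      by (simp add: power_Suc2 mult.assoc del: power_Suc)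
    then show ?thesis
      by (intro ext) (auto simp: compose_def diag_map_def H5_def mult.assoc power_Suc[of q] simp del: power_Suc)
  qed
  finally show ?case .
qed

lemma diag_isometry_ord:
  assumes n: "norm l = 1" "norm m = 1" and k: "k > 0" "l ^ k = 1" "m ^ k = 1"
    and jb: "0 < jorgensen_const l m" "jorgensen_const l m < 1"
  shows "7 \<le> isometry_ord (mat2 l 0 0 m)"
proof -
  interpret B: group "BijGroup H5" by (rule group_BijGroup)
  define f where "f = diag_map l (qcnj m)"
  have nz: "l \<noteq> 0" "qcnj m \<noteq> 0"
    using n norm_qcnj[of m] by (auto simp del: norm_qcnj)
  have f: "f \<in> carrier (BijGroup H5)"
    using diag_map_Bij[OF nz] by (simp add: f_def BijGroup_def)
  have "restrict (poincare_ext (mat2 l 0 0 m)) H5 = f"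
    by (rule ext) (auto simp: f_def diag_map_def poincare_ext_diag[OF n(2)])
  then have ord: "isometry_ord (mat2 l 0 0 m) = B.ord f"
    by (simp add: isometry_ord_def)
  have qcp: "qcnj m ^ i = qcnj (m ^ i)" for i
  proof (induction i)
    case 0
    show ?case by (simp add: quat_eq_iff)
  next
    case (Suc i)
    have "qcnj m ^ Suc i = qcnj m ^ i * qcnj m"
      by (rule power_Suc2)
    with Suc show ?case by (simp add: qcnj_mult)
  qed
  have one: "f [^]\<^bsub>BijGroup H5\<^esub> i = \<one>\<^bsub>BijGroup H5\<^esub> \<longleftrightarrow> (\<forall>z. l ^ i * z * qcnj m ^ i = z)" for i :: nat
  proof
    assume *: "f [^]\<^bsub>BijGroup H5\<^esub> i = \<one>\<^bsub>BijGroup H5\<^esub>"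
    show "\<forall>z. l ^ i * z * qcnj m ^ i = z"
    proof
      fix z
      have "(z, 1) \<in> H5" by (simp add: H5_def)
      then show "l ^ i * z * qcnj m ^ i = z"
        using fun_cong[OF *[unfolded f_def diag_map_pow[OF nz]], of "(z, 1)"]
        by (simp add: diag_map_def BijGroup_def)
    qed
  next
    assume "\<forall>z. l ^ i * z * qcnj m ^ i = z"
    then show "f [^]\<^bsub>BijGroup H5\<^esub> i = \<one>\<^bsub>BijGroup H5\<^esub>"
      unfolding f_def diag_map_pow[OF nz] by (auto simp: diag_map_def BijGroup_def restrict_def)
  qed
  have "qcnj 1 = 1"
    by (simp add: quat_eq_iff)
  then have "f [^]\<^bsub>BijGroup H5\<^esub> k = \<one>\<^bsub>BijGroup H5\<^esub>"
    unfolding one qcp k by simp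
  then have "B.ord f dvd k"
    by (simp add: B.pow_eq_id[OF f])
  \<comment> \<open>This excludes the value 0, which stands for infinite order.\<close>
  then have "B.ord f > 0"
    using k(1) by (metis dvd_0_left_iff gr_zeroI less_irrefl)
  moreover have "f [^]\<^bsub>BijGroup H5\<^esub> B.ord f = \<one>\<^bsub>BijGroup H5\<^esub>"
    by (simp add: B.pow_eq_id[OF f])
  ultimately show ?thesis
    unfolding ord one using n jb by (intro diag_order_ge_7) auto
qed

theorem corollary4p2:
  fixes a b c d l m :: quat and S T :: "quat^2^2"
  assumes "S = mat2 a b c d" and "T = mat2 l 0 0 m"
    and "S \<in> carrier SL2H" and "T \<in> carrier SL2H"
    and "discrete (generate SL2H {S, T})"
    and "\<not> elementary (generate SL2H {S, T})"
    and "((qRe l - qRe m)\<^sup>2 + (norm (qIm l) + norm (qIm m))\<^sup>2) * (1 + norm (b * c)) = 1"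
  shows "elliptic T \<and> 7 \<le> isometry_ord T"
proof -
  interpret SL: group SL2H by (rule group_SL2H)
  define G where "G = generate SL2H {S, T}"
  have G: "subgroup G SL2H"
    unfolding G_def using assms(3,4) by (intro SL.generate_is_subgroup) auto
  have disc: "discrete G" and SG: "mat2 a b c d \<in> G" and TG: "mat2 l 0 0 m \<in> G"
    using assms(1,2,5) by (auto simp: G_def intro: generate.incl)
  have DS: "qdet_sq a b c d = 1" and DT: "qdet_sq l 0 0 m = 1"
    using assms(1-4) by (simp_all add: mat2_in_SL2H)
  have nz: "b \<noteq> 0" "c \<noteq> 0" "a \<noteq> 0 \<or> d \<noteq> 0"
    using elementary_cases[OF DS DT] assms(1,2,6) by auto
  have jb: "jorgensen_const l m * (1 + norm b * norm c) = 1"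
    using assms(7) by (simp add: jorgensen_const_def norm_mult)
  have "norm l = norm m"
    using no_discrete_loxodromic[OF G disc TG _ SG nz] jb by auto
  moreover have "norm l * norm m = 1"
    by (rule diag_norm_prod[OF G TG])
  ultimately have n: "norm l = 1" "norm m = 1"
    by (metis abs_norm_cancel abs_square_eq_1 power2_eq_square)+
  have x: "norm b * norm c > 0"
    using nz by simp
  have jb0: "0 < jorgensen_const l m"
    using jb by (metis jorgensen_const_def less_eq_real_def mult_zero_left sum_power2_ge_zero zero_neq_one)
  \<comment> \<open>Strict because \<open>b\<close> and \<open>c\<close> are nonzero; a primitive
    sixth root of unity has distance exactly 1 from 1.\<close>
  have "jorgensen_const l m < 1"
    using jb mult_pos_pos[OF jb0 x] by (simp add: distrib_left)
  moreover obtain k where "k > 0" "l ^ k = 1" "m ^ k = 1"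
    using discrete_diag_finite_order[OF G disc TG n] by blast
  ultimately have "7 \<le> isometry_ord T"
    using n jb0 diag_isometry_ord assms(2) by blast
  moreover have "(0, 1) \<in> H5" "poincare_ext T (0, 1) = (0, 1)"
    using n by (simp_all add: H5_def assms(2) poincare_ext_diag)
  then have "elliptic T"
    unfolding elliptic_def by blast
  ultimately show ?thesis
    by blast
qed

end
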